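(* Let $\alpha > 1$ and let $p \ge 1$ be an integer. Let $\mu_1,\ldots,\mu_p$ be fixed centered probability laws on $\mathbb{R}$ with unit variance and a finite moment of order $2\alpha$. For all integers $n_0,\ldots,n_p \ge 1$, let $A^{(1)} \in \mathbb{R}^{n_0\times n_1}, \ldots, A^{(p)} \in \mathbb{R}^{n_{p-1}\times n_p}$ be independent random matrices such that, for each $q$, the entries of $A^{(q)}$ are i.i.d. with law $\mu_q$, and let $P := A^{(1)} \cdots A^{(p)} \in \mathbb{R}^{n_0 \times n_p}$. Then, as $n_0 \asymp \cdots \asymp n_p \to \infty$, the random variable $$(n_0 \cdots n_p)^{-\frac 1 2} \sum_{i = 1}^{n_0} \sum_{j = 1}^{n_p} P_{ij}$$ converges in law to a centered Gaussian random variable of unit variance.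
   Context: Convergence in law as $n_0 \asymp \cdots \asymp n_p \to \infty$ means: for every $C<+\infty$, the convergence in law holds along every sequence of tuples $(n_0,\ldots,n_p)$ such that $\min_q n_q \to \infty$ and $n_q \le C n_{q'}$ for all $q,q'\in\{0,\ldots,p\}$. *)

theory Defs
  imports "HOL-Probability.Probability" "Jordan_Normal_Form.Matrix"
begin

primrec mat_chain :: "nat \<Rightarrow> (nat \<Rightarrow> real mat) \<Rightarrow> nat \<Rightarrow> real mat" where
  "mat_chain r B 0 = 1\<^sub>m r"
| "mat_chain r B (Suc k) = mat_chain r B k * B (Suc k)"

definition iid_entries :: "'a measure \<Rightarrow> nat \<Rightarrow> nat \<Rightarrow> ('a \<Rightarrow> real mat) \<Rightarrow> real measure \<Rightarrow> bool" where
  "iid_entries M r c X \<nu> \<longleftrightarrow>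
     (\<forall>\<omega>\<in>space M. X \<omega> \<in> carrier_mat r c) \<and>
     prob_space.indep_vars M (\<lambda>_. borel) (\<lambda>ij \<omega>. X \<omega> $$ ij) ({..<r} \<times> {..<c}) \<and>
     (\<forall>ij \<in> {..<r} \<times> {..<c}. distr M borel (\<lambda>\<omega>. X \<omega> $$ ij) = \<nu>)"

(* The type of matrices carries no sigma-algebra here: an r-by-c random matrix is regarded as
   a random element of the finite product space of functions on {..<r} x {..<c}. *)
definition indep_matrices ::
    "'a measure \<Rightarrow> (nat \<Rightarrow> nat) \<Rightarrow> (nat \<Rightarrow> nat) \<Rightarrow> (nat \<Rightarrow> 'a \<Rightarrow> real mat) \<Rightarrow> nat set \<Rightarrow> bool" where
  "indep_matrices M r c X I \<longleftrightarrow>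
     prob_space.indep_vars M
       (\<lambda>q. PiM ({..<r q} \<times> {..<c q}) (\<lambda>_. borel))
       (\<lambda>q \<omega>. restrict (($$) (X q \<omega>)) ({..<r q} \<times> {..<c q})) I"

(* A tuple (n_0, ..., n_p) is a function nat => nat of which only the values on {..p} matter. *)
definition conv_law_comparable ::
    "nat \<Rightarrow> ((nat \<Rightarrow> nat) \<Rightarrow> real measure) \<Rightarrow> real measure \<Rightarrow> bool" where
  "conv_law_comparable p L \<nu> \<longleftrightarrow>
     (\<forall>(C::real) (n :: nat \<Rightarrow> nat \<Rightarrow> nat).
        (\<forall>k. \<forall>q\<le>p. n k q \<ge> 1) \<longrightarrow>
        filterlim (\<lambda>k. Min (n k ` {..p})) at_top sequentially \<longrightarrow>
        (\<forall>k. \<forall>q\<le>p. \<forall>q'\<le>p. real (n k q) \<le> C * real (n k q')) \<longrightarrow>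
        weak_conv_m (\<lambda>k. L (n k)) \<nu>)"

end

theory Submission
  imports Defs
begin

text \<open>
  Write the normalized sum as \<open>v\<^sub>p \<cdot> 1\<close>, where \<open>v\<^sub>0\<close> is the constant unit vector and
  \<open>v\<^sub>q = v\<^bsub>q-1\<^esub> A\<^sup>(\<^sup>q\<^sup>) / sqrt n\<^sub>q\<close>. Because distinct paths are uncorrelated, applying centered
  functions to the entries, \<open>f\<^sub>q\<close> in one copy and \<open>g\<^sub>q\<close> in another, gives two sums whose correlation is
  exactly the product of the one-entry correlations \<open>E f\<^sub>q g\<^sub>q\<close>, whatever the dimensions.
  Hence the entries may be replaced by bounded standardized ones at an \<open>L\<^sup>2\<close> cost that is uniform in
  the dimensions. For bounded entries a fourth-moment computation shows that
  \<open>E |v\<^sub>q|\<^sup>4\<close> grows by a factor at most \<open>1 + K / n\<^sub>q\<close> in each step, while \<open>E |v\<^sub>q|\<^sup>2 = 1\<close>, so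
  \<open>|v\<^sub>q|\<^sup>2\<close> tends to 1 in \<open>L\<^sup>2\<close>. Given \<open>v\<^bsub>p-1\<^esub>\<close>, the sum is a linear form in independent
  entries with coefficients \<open>v\<^bsub>p-1\<^esub>(i) / sqrt n\<^sub>p\<close>, which are uniformly small, and its characteristic
  function is close to that of a Gaussian of variance \<open>|v\<^bsub>p-1\<^esub>|\<^sup>2\<close>. Levy's continuity theorem concludes.
\<close>

section \<open>Moments of sums of independent bounded variables\<close>

context prob_space
begin

text \<open>The bound holds at every point, not merely almost everywhere, so that closure under sums
  and products is a pointwise estimate. All moments then exist, and the expansions below need no
  separate integrability arguments.\<close>

definition bounded_rv :: "('a \<Rightarrow> real) \<Rightarrow> bool" where
  "bounded_rv X \<longleftrightarrow> X \<in> borel_measurable M \<and> (\<exists>B. \<forall>\<omega>. \<bar>X \<omega>\<bar> \<le> B)"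

lemma bounded_rv_measurable [measurable_dest]: "bounded_rv X \<Longrightarrow> X \<in> borel_measurable M"
  by (simp add: bounded_rv_def)

lemma bounded_rv_integrable: "bounded_rv X \<Longrightarrow> integrable M X"
  unfolding bounded_rv_def by (metis AE_I2 integrable_const_bound real_norm_def)

lemma bounded_rv_const [intro, simp]: "bounded_rv (\<lambda>_. c)"
  by (auto simp: bounded_rv_def)

lemma bounded_rv_add [intro]:
  assumes "bounded_rv X" "bounded_rv Y"
  shows "bounded_rv (\<lambda>\<omega>. X \<omega> + Y \<omega>)"
proof -
  obtain B C where "\<forall>\<omega>. \<bar>X \<omega>\<bar> \<le> B" "\<forall>\<omega>. \<bar>Y \<omega>\<bar> \<le> C"
    using assms by (auto simp: bounded_rv_def)
  then have "\<forall>\<omega>. \<bar>X \<omega> + Y \<omega>\<bar> \<le> B + C"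
    by (meson abs_triangle_ineq add_mono order_trans)
  then show ?thesis
    using assms by (auto simp: bounded_rv_def)
qed

lemma bounded_rv_mult [intro]:
  assumes "bounded_rv X" "bounded_rv Y"
  shows "bounded_rv (\<lambda>\<omega>. X \<omega> * Y \<omega>)"
proof -
  obtain B C where "\<forall>\<omega>. \<bar>X \<omega>\<bar> \<le> B" "\<forall>\<omega>. \<bar>Y \<omega>\<bar> \<le> C"
    using assms by (auto simp: bounded_rv_def)
  then have "\<forall>\<omega>. \<bar>X \<omega> * Y \<omega>\<bar> \<le> B * C"
    unfolding abs_mult by (meson abs_ge_zero mult_mono order_trans)
  then show ?thesis
    using assms by (auto simp: bounded_rv_def)
qed

lemma bounded_rv_power [intro]: "bounded_rv X \<Longrightarrow> bounded_rv (\<lambda>\<omega>. X \<omega> ^ k)"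
  by (induction k) auto

lemma bounded_rv_sum [intro]: "(\<And>i. i \<in> I \<Longrightarrow> bounded_rv (X i)) \<Longrightarrow> bounded_rv (\<lambda>\<omega>. \<Sum>i\<in>I. X i \<omega>)"
  by (induction I rule: infinite_finite_induct) auto

lemma expectation_indep_powers:
  assumes "indep_var borel X borel Y" "bounded_rv X" "bounded_rv Y"
  shows "expectation (\<lambda>\<omega>. X \<omega> ^ a * Y \<omega> ^ b) = expectation (\<lambda>\<omega>. X \<omega> ^ a) * expectation (\<lambda>\<omega>. Y \<omega> ^ b)"
proof -
  have "indep_var borel ((\<lambda>x. x ^ a) \<circ> X) borel ((\<lambda>x. x ^ b) \<circ> Y)"
    using assms(1) by (rule indep_var_compose) auto
  then have "indep_var borel (\<lambda>\<omega>. X \<omega> ^ a) borel (\<lambda>\<omega>. Y \<omega> ^ b)"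
    by (simp add: comp_def)
  then show ?thesis
    using assms(2,3) by (intro indep_var_lebesgue_integral bounded_rv_integrable) auto
qed

text \<open>Induction on the index set; the first two moments are carried along because the fourth
  needs them. Expanding \<open>(Z i \<omega> + S \<omega>) ^ 4\<close>, the mixed terms of odd
  degree vanish by independence and centering. What remains of the mixed terms is
  \<open>6 * (s i * sum s I)\<close>, and \<open>3 \<le> K\<close> bounds it by
  \<open>2 * K * (s i * sum s I)\<close>, which completes the square.\<close>

lemma moments_indep_sum:
  fixes K :: real
  assumes "finite I" "indep_vars (\<lambda>_. borel) Z I"
    and "\<And>i. i \<in> I \<Longrightarrow> bounded_rv (Z i)"
    and "\<And>i. i \<in> I \<Longrightarrow> expectation (Z i) = 0"
    and "\<And>i. i \<in> I \<Longrightarrow> expectation (\<lambda>\<omega>. Z i \<omega> ^ 2) = s i"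
    and "\<And>i. i \<in> I \<Longrightarrow> expectation (\<lambda>\<omega>. Z i \<omega> ^ 4) \<le> K * s i ^ 2"
    and "\<And>i. i \<in> I \<Longrightarrow> s i \<ge> 0" and "3 \<le> K"
  shows "expectation (\<lambda>\<omega>. \<Sum>i\<in>I. Z i \<omega>) = 0 \<and>
    expectation (\<lambda>\<omega>. (\<Sum>i\<in>I. Z i \<omega>) ^ 2) = sum s I \<and>
    expectation (\<lambda>\<omega>. (\<Sum>i\<in>I. Z i \<omega>) ^ 4) \<le> K * (sum s I) ^ 2"
  using assms(1-7)
proof (induction I rule: finite_induct)
  case empty
  then show ?case by simp
next
  case (insert i I)
  define S where "S = (\<lambda>\<omega>. \<Sum>i\<in>I. Z i \<omega>)"
  have "indep_vars (\<lambda>_. borel) Z I"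
    using insert.prems(1) by (rule indep_vars_subset) auto
  then have IH: "expectation S = 0" "expectation (\<lambda>\<omega>. S \<omega> ^ 2) = sum s I"
      "expectation (\<lambda>\<omega>. S \<omega> ^ 4) \<le> K * (sum s I) ^ 2"
    using insert by (simp_all add: S_def)
  have ind: "indep_var borel (Z i) borel S"
    unfolding S_def using insert by (intro indep_vars_sum) auto
  have bZ: "bounded_rv (Z i)" and bS: "bounded_rv S"
    using insert.prems by (auto simp: S_def)
  note [intro] = bZ bS
  note prod = expectation_indep_powers[OF ind bZ bS]
  have EZ: "expectation (Z i) = 0" "expectation (\<lambda>\<omega>. Z i \<omega> ^ 2) = s i"
      "expectation (\<lambda>\<omega>. Z i \<omega> ^ 4) \<le> K * s i ^ 2"
    using insert.prems by auto
  have 1: "expectation (\<lambda>\<omega>. Z i \<omega> + S \<omega>) = 0"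
    using IH EZ by (subst Bochner_Integration.integral_add) (auto intro: bounded_rv_integrable)
  have "expectation (\<lambda>\<omega>. (Z i \<omega> + S \<omega>) ^ 2) =
      expectation (\<lambda>\<omega>. Z i \<omega> ^ 2 + 2 * (Z i \<omega> ^ 1 * S \<omega> ^ 1) + S \<omega> ^ 2)"
    by (simp add: power2_sum algebra_simps)
  also have "\<dots> = expectation (\<lambda>\<omega>. Z i \<omega> ^ 2) + 2 * expectation (\<lambda>\<omega>. Z i \<omega> ^ 1 * S \<omega> ^ 1) + expectation (\<lambda>\<omega>. S \<omega> ^ 2)"
    by ((subst Bochner_Integration.integral_add Bochner_Integration.integral_mult_right_zero;
       (intro bounded_rv_integrable bounded_rv_add bounded_rv_mult bounded_rv_power bounded_rv_const bZ bS)?)+, (rule refl)?)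
  also have "\<dots> = s i + sum s I"
    unfolding prod using IH EZ by simp
  finally have 2: "expectation (\<lambda>\<omega>. (Z i \<omega> + S \<omega>) ^ 2) = s i + sum s I" .
  have "expectation (\<lambda>\<omega>. (Z i \<omega> + S \<omega>) ^ 4) =
      expectation (\<lambda>\<omega>. Z i \<omega> ^ 4 + 4 * (Z i \<omega> ^ 3 * S \<omega> ^ 1) + 6 * (Z i \<omega> ^ 2 * S \<omega> ^ 2)
        + 4 * (Z i \<omega> ^ 1 * S \<omega> ^ 3) + S \<omega> ^ 4)"
    by (intro Bochner_Integration.integral_cong refl) (simp add: power4_eq_xxxx power2_eq_square power3_eq_cube algebra_simps)
  also have "\<dots> = expectation (\<lambda>\<omega>. Z i \<omega> ^ 4) + 4 * expectation (\<lambda>\<omega>. Z i \<omega> ^ 3 * S \<omega> ^ 1)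
     + 6 * expectation (\<lambda>\<omega>. Z i \<omega> ^ 2 * S \<omega> ^ 2)
        + 4 * expectation (\<lambda>\<omega>. Z i \<omega> ^ 1 * S \<omega> ^ 3) + expectation (\<lambda>\<omega>. S \<omega> ^ 4)"
    by ((subst Bochner_Integration.integral_add Bochner_Integration.integral_mult_right_zero;
       (intro bounded_rv_integrable bounded_rv_add bounded_rv_mult bounded_rv_power bounded_rv_const bZ bS)?)+, (rule refl)?)
  also have "\<dots> = expectation (\<lambda>\<omega>. Z i \<omega> ^ 4) + 6 * (s i * sum s I) + expectation (\<lambda>\<omega>. S \<omega> ^ 4)"
    unfolding prod using IH EZ by simp
  also have "\<dots> \<le> K * s i ^ 2 + 2 * K * (s i * sum s I) + K * (sum s I) ^ 2"
    using IH EZ \<open>3 \<le> K\<close> insert.prems by (intro add_mono mult_right_mono) (auto intro!: sum_nonneg mult_nonneg_nonneg)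
  also have "\<dots> = K * (s i + sum s I) ^ 2"
    by (simp add: power2_eq_square algebra_simps)
  finally have 4: "expectation (\<lambda>\<omega>. (Z i \<omega> + S \<omega>) ^ 4) \<le> K * (s i + sum s I) ^ 2" .
  show ?case
    using 1 2 4 insert.hyps by (simp add: S_def)
qed

text \<open>Each off-diagonal pair contributes the product of its means, \<open>s ^ 2\<close>, and
  there are at most \<open>card J ^ 2\<close> such pairs; each diagonal term costs at most
  \<open>K * s ^ 2\<close>.\<close>

lemma second_moment_indep_sum:
  fixes s K :: real
  assumes "finite J" "indep_vars (\<lambda>_. borel) W J"
    and "\<And>j. j \<in> J \<Longrightarrow> bounded_rv (W j)"
    and "\<And>j. j \<in> J \<Longrightarrow> expectation (W j) = s"
    and "\<And>j. j \<in> J \<Longrightarrow> expectation (\<lambda>\<omega>. W j \<omega> ^ 2) \<le> K * s ^ 2"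
  shows "expectation (\<lambda>\<omega>. \<Sum>j\<in>J. W j \<omega>) = card J * s \<and>
    expectation (\<lambda>\<omega>. (\<Sum>j\<in>J. W j \<omega>) ^ 2) \<le> (card J ^ 2 + K * card J) * s ^ 2"
  using assms
proof (induction J rule: finite_induct)
  case empty
  then show ?case by simp
next
  case (insert i J)
  define S where "S = (\<lambda>\<omega>. \<Sum>i\<in>J. W i \<omega>)"
  have "indep_vars (\<lambda>_. borel) W J"
    using insert.prems(1) by (rule indep_vars_subset) auto
  then have IH: "expectation S = card J * s"
      "expectation (\<lambda>\<omega>. S \<omega> ^ 2) \<le> (card J ^ 2 + K * card J) * s ^ 2"
    using insert by (simp_all add: S_def)
  have ind: "indep_var borel (W i) borel S"
    unfolding S_def using insert by (intro indep_vars_sum) auto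
  have bZ: "bounded_rv (W i)" and bS: "bounded_rv S"
    using insert.prems by (auto simp: S_def)
  note [intro] = bZ bS
  note prod = expectation_indep_powers[OF ind bZ bS]
  have EZ: "expectation (W i) = s" "expectation (\<lambda>\<omega>. W i \<omega> ^ 2) \<le> K * s ^ 2"
    using insert.prems by auto
  have 1: "expectation (\<lambda>\<omega>. W i \<omega> + S \<omega>) = s + card J * s"
    using IH EZ by (subst Bochner_Integration.integral_add) (auto intro: bounded_rv_integrable)
  have "expectation (\<lambda>\<omega>. (W i \<omega> + S \<omega>) ^ 2) =
      expectation (\<lambda>\<omega>. W i \<omega> ^ 2 + 2 * (W i \<omega> ^ 1 * S \<omega> ^ 1) + S \<omega> ^ 2)"
    by (simp add: power2_sum algebra_simps)
  also have "\<dots> = expectation (\<lambda>\<omega>. W i \<omega> ^ 2) + 2 * expectation (\<lambda>\<omega>. W i \<omega> ^ 1 * S \<omega> ^ 1) + expectation (\<lambda>\<omega>. S \<omega> ^ 2)"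
    by ((subst Bochner_Integration.integral_add Bochner_Integration.integral_mult_right_zero;
       (intro bounded_rv_integrable bounded_rv_add bounded_rv_mult bounded_rv_power bounded_rv_const bZ bS)?)+, (rule refl)?)
  also have "\<dots> = expectation (\<lambda>\<omega>. W i \<omega> ^ 2) + 2 * (card J * s ^ 2) + expectation (\<lambda>\<omega>. S \<omega> ^ 2)"
    unfolding prod using IH EZ by (simp add: power2_eq_square)
  also have "\<dots> \<le> K * s ^ 2 + 2 * (card J * s ^ 2) + (card J ^ 2 + K * card J) * s ^ 2"
    using IH EZ by simp
  \<comment> \<open>The two sides differ by exactly \<open>s ^ 2\<close>.\<close>
  also have "\<dots> \<le> ((card J + 1) ^ 2 + K * (card J + 1)) * s ^ 2"
    by (simp add: power2_eq_square algebra_simps)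
  finally show ?case
    using 1 insert.hyps by (simp add: S_def algebra_simps)
qed

text \<open>One step of the chain with the incoming vector frozen to \<open>a\<close>. Within a
  column, \<open>moments_indep_sum\<close> gives second moment \<open>s\<close> and fourth moment at
  most \<open>K * s ^ 2\<close>; across columns the squares are independent with mean
  \<open>s\<close>, so \<open>second_moment_indep_sum\<close> applies. Division by
  \<open>card J ^ 2\<close> will turn the constant into \<open>1 + K / card J\<close>.\<close>

lemma second_moment_sum_squares:
  fixes Y :: "'i \<times> 'j \<Rightarrow> 'a \<Rightarrow> real" and a :: "'i \<Rightarrow> real" and K :: real
  assumes fin: "finite I" "finite J" and ind: "indep_vars (\<lambda>_. borel) Y (I \<times> J)"
    and b: "\<And>t. t \<in> I \<times> J \<Longrightarrow> bounded_rv (Y t)"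
    and m1: "\<And>t. t \<in> I \<times> J \<Longrightarrow> expectation (Y t) = 0"
    and m2: "\<And>t. t \<in> I \<times> J \<Longrightarrow> expectation (\<lambda>\<omega>. Y t \<omega> ^ 2) = 1"
    and m4: "\<And>t. t \<in> I \<times> J \<Longrightarrow> expectation (\<lambda>\<omega>. Y t \<omega> ^ 4) \<le> K" and K: "3 \<le> K"
  shows "expectation (\<lambda>\<omega>. (\<Sum>j\<in>J. (\<Sum>i\<in>I. a i * Y (i, j) \<omega>) ^ 2) ^ 2)
    \<le> (card J ^ 2 + K * card J) * (\<Sum>i\<in>I. a i ^ 2) ^ 2"
proof -
  define s where "s = (\<Sum>i\<in>I. a i ^ 2)"
  \<comment> \<open>The sum runs over the block \<open>I \<times> {j}\<close> instead of
    \<open>I\<close> because the independence of the columns is obtained by restricting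
    \<open>Y\<close> to disjoint blocks of its own index set.\<close>
  define Z where "Z = (\<lambda>j \<omega>. \<Sum>t\<in>I \<times> {j}. a (fst t) * Y t \<omega>)"
  have Z: "Z j \<omega> = (\<Sum>i\<in>I. a i * Y (i, j) \<omega>)" for j \<omega>
    by (simp add: Z_def sum.cartesian_product')
  have s: "(\<Sum>t\<in>I \<times> {j}. a (fst t) ^ 2) = s" for j :: 'j
    by (simp add: s_def sum.cartesian_product')
  have bZ: "bounded_rv (Z j)" if "j \<in> J" for j
    unfolding Z_def using b that by (intro bounded_rv_sum bounded_rv_mult bounded_rv_const) auto
  have *: "expectation (Z j) = 0 \<and> expectation (\<lambda>\<omega>. Z j \<omega> ^ 2) = s \<and>
    expectation (\<lambda>\<omega>. Z j \<omega> ^ 4) \<le> K * s ^ 2" if j: "j \<in> J" for j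
    unfolding Z_def s[of j, symmetric]
  proof (rule moments_indep_sum)
    have "indep_vars (\<lambda>_. borel) Y (I \<times> {j})"
      using ind by (rule indep_vars_subset) (use j in auto)
    then show "indep_vars (\<lambda>_. borel) (\<lambda>t \<omega>. a (fst t) * Y t \<omega>) (I \<times> {j})"
      by (rule indep_vars_compose2) auto
    have a4: "a (fst t) ^ 4 = (a (fst t))\<^sup>2 ^ 2" for t :: "'i \<times> 'j"
      by simp
    show "expectation (\<lambda>\<omega>. (a (fst t) * Y t \<omega>) ^ 4) \<le> K * ((a (fst t))\<^sup>2)\<^sup>2" if "t \<in> I \<times> {j}" for t
      using m4[of t] that j unfolding a4[symmetric] by (auto simp: power_mult_distrib mult.commute[of K] intro!: mult_left_mono)
  qed (use fin b m1 m2 K j in \<open>auto simp: power_mult_distrib\<close>)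
  have "indep_vars (\<lambda>j. PiM (I \<times> {j}) (\<lambda>_. borel)) (\<lambda>j \<omega>. restrict (\<lambda>t. Y t \<omega>) (I \<times> {j})) J"
    using ind by (rule indep_vars_restrict) (auto simp: disjoint_family_on_def)
  then have "indep_vars (\<lambda>_. borel)
      (\<lambda>j \<omega>. (\<Sum>t\<in>I \<times> {j}. a (fst t) * restrict (\<lambda>t. Y t \<omega>) (I \<times> {j}) t) ^ 2) J"
    by (rule indep_vars_compose2) measurable
  then have "indep_vars (\<lambda>_. borel) (\<lambda>j \<omega>. Z j \<omega> ^ 2) J"
    by (simp add: Z_def cong: sum.cong)
  from second_moment_indep_sum[OF fin(2) this, of s K] show ?thesis
    using * bZ by (auto simp: Z[symmetric] s_def[symmetric])
qed

text \<open>A substitute for conditioning on \<open>X\<close>: the joint law of independent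
  variables is a product measure, and Fubini integrates \<open>Y\<close> out with the value of
  \<open>X\<close> frozen. The Banach-valued codomain covers both real moments and complex
  characteristic functions.\<close>

lemma expectation_decouple:
  fixes F :: "'b \<times> 'b \<Rightarrow> 'd::{banach, second_countable_topology}"
  assumes ind: "indep_var S X T Y" and F: "F \<in> borel_measurable (S \<Otimes>\<^sub>M T)"
    and int: "integrable M (\<lambda>\<omega>. F (X \<omega>, Y \<omega>))"
  shows "integrable M (\<lambda>\<omega>. expectation (\<lambda>\<omega>'. F (X \<omega>, Y \<omega>')))"
    and "expectation (\<lambda>\<omega>. F (X \<omega>, Y \<omega>)) = expectation (\<lambda>\<omega>. expectation (\<lambda>\<omega>'. F (X \<omega>, Y \<omega>')))"
proof -
  have X: "X \<in> measurable M S" and Y: "Y \<in> measurable M T"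
    and eq: "distr M S X \<Otimes>\<^sub>M distr M T Y = distr M (S \<Otimes>\<^sub>M T) (\<lambda>x. (X x, Y x))"
    using ind by (auto simp: indep_var_distribution_eq)
  note [measurable] = X Y F
  interpret S: prob_space "distr M S X" by (rule prob_space_distr) fact
  interpret T: prob_space "distr M T Y" by (rule prob_space_distr) fact
  interpret ST: pair_prob_space "distr M S X" "distr M T Y" ..
  have int': "integrable (distr M S X \<Otimes>\<^sub>M distr M T Y) F"
    unfolding eq using int by (subst integrable_distr_eq) auto
  have inner: "(\<integral>y. F (x, y) \<partial>distr M T Y) = expectation (\<lambda>\<omega>'. F (x, Y \<omega>'))" if "x \<in> space S" for x
    using that by (intro integral_distr) auto
  have "integrable (distr M S X) (\<lambda>x. \<integral>y. F (x, y) \<partial>distr M T Y)"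
    using ST.integrable_fst[of "\<lambda>x y. F (x, y)"] int' by simp
  then have "integrable M (\<lambda>\<omega>. \<integral>y. F (X \<omega>, y) \<partial>distr M T Y)"
    by (subst (asm) integrable_distr_eq) auto
  then show "integrable M (\<lambda>\<omega>. expectation (\<lambda>\<omega>'. F (X \<omega>, Y \<omega>')))"
    using measurable_space[OF X] by (auto simp: inner cong: Bochner_Integration.integrable_cong)
  have "expectation (\<lambda>\<omega>. F (X \<omega>, Y \<omega>)) = (\<integral>z. F z \<partial>(distr M S X \<Otimes>\<^sub>M distr M T Y))"
    unfolding eq by (subst integral_distr) auto
  also have "\<dots> = (\<integral>x. (\<integral>y. F (x, y) \<partial>distr M T Y) \<partial>distr M S X)"
    using ST.integral_fst[of "\<lambda>x y. F (x, y)"] int' by simp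
  also have "\<dots> = expectation (\<lambda>\<omega>. \<integral>y. F (X \<omega>, y) \<partial>distr M T Y)"
    by (subst integral_distr) auto
  also have "\<dots> = expectation (\<lambda>\<omega>. expectation (\<lambda>\<omega>'. F (X \<omega>, Y \<omega>')))"
    using measurable_space[OF X] by (intro Bochner_Integration.integral_cong) (auto simp: inner)
  finally show "expectation (\<lambda>\<omega>. F (X \<omega>, Y \<omega>)) = expectation (\<lambda>\<omega>. expectation (\<lambda>\<omega>'. F (X \<omega>, Y \<omega>')))" .
qed

end

section \<open>Gaussian approximation of weighted sums with explicit error\<close>

text \<open>The upper bound on \<open>exp (- x)\<close> inverts the quadratic Taylor minorant of
  \<open>exp x\<close>: the product of \<open>1 - x + x\<^sup>2 / 2\<close> and
  \<open>1 + x + x\<^sup>2 / 2\<close> is \<open>1 + x ^ 4 / 4\<close>, hence at least 1.\<close>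

lemma one_minus_exp_bound:
  fixes x :: real
  assumes "x \<ge> 0"
  shows "\<bar>(1 - x) - exp (- x)\<bar> \<le> x ^ 2 / 2"
proof -
  have 1: "1 - x \<le> exp (- x)"
    using exp_ge_add_one_self[of "-x"] by simp
  have "exp (- x) \<le> 1 / (1 + x + x\<^sup>2 / 2)"
    using exp_lower_Taylor_quadratic[OF assms] assms
    by (simp add: exp_minus inverse_eq_divide add_pos_nonneg frac_le)
  also have "\<dots> \<le> 1 - x + x\<^sup>2 / 2"
  proof -
    have "(1 - x + x\<^sup>2 / 2) * (1 + x + x\<^sup>2 / 2) = 1 + x ^ 4 / 4"
      by (simp add: power2_eq_square power4_eq_xxxx algebra_simps)
    then show ?thesis
      using assms by (simp add: divide_le_eq add_pos_nonneg)
  qed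
  finally show ?thesis
    using 1 by simp
qed

context prob_space
begin

text \<open>Both sides factor over \<open>I\<close>, and products of numbers of modulus at most 1
  differ by at most the sum of the differences of their factors. Each factor is compared with
  \<open>1 - c i ^ 2 / 2\<close>. The weights are not normalized, so the lemma applies to a frozen
  random vector whose norm is only close to 1.\<close>

lemma char_weighted_sum_approx:
  assumes "finite I" and ind: "indep_vars (\<lambda>_. borel) Y I"
    and Y: "\<And>i. i \<in> I \<Longrightarrow> Y i \<in> borel_measurable M" "\<And>i \<omega>. i \<in> I \<Longrightarrow> \<bar>Y i \<omega>\<bar> \<le> B"
    and m1: "\<And>i. i \<in> I \<Longrightarrow> expectation (Y i) = 0"
    and m2: "\<And>i. i \<in> I \<Longrightarrow> expectation (\<lambda>\<omega>. Y i \<omega> ^ 2) = 1"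
  shows "cmod (expectation (\<lambda>\<omega>. iexp (\<Sum>i\<in>I. c i * Y i \<omega>)) - exp (- (\<Sum>i\<in>I. c i ^ 2) / 2))
    \<le> (\<Sum>i\<in>I. B * \<bar>c i\<bar> ^ 3 / 6 + c i ^ 4 / 8)"
proof -
  have [measurable]: "i \<in> I \<Longrightarrow> Y i \<in> borel_measurable M" for i by (rule Y)
  define D where "D = (\<lambda>i. distr M borel (\<lambda>\<omega>. c i * Y i \<omega>))"
  have "indep_vars (\<lambda>_. borel) (\<lambda>i \<omega>. c i * Y i \<omega>) I"
    using ind by (rule indep_vars_compose2) auto
  \<comment> \<open>The characteristic function is evaluated at 1 only; its argument will be
    absorbed into the weights \<open>c\<close>.\<close>
  from char_distr_sum[OF this, of 1]
  have "expectation (\<lambda>\<omega>. iexp (\<Sum>i\<in>I. c i * Y i \<omega>)) = (\<Prod>i\<in>I. char (D i) 1)"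
    by (simp add: char_def integral_distr D_def)
  moreover have "complex_of_real (exp (- (\<Sum>i\<in>I. c i ^ 2) / 2)) = (\<Prod>i\<in>I. complex_of_real (exp (- (c i ^ 2) / 2)))"
    using \<open>finite I\<close> by (simp flip: exp_sum of_real_prod add: sum_negf sum_divide_distrib)
  moreover have "cmod ((\<Prod>i\<in>I. char (D i) 1) - (\<Prod>i\<in>I. complex_of_real (exp (- (c i ^ 2) / 2))))
      \<le> (\<Sum>i\<in>I. cmod (char (D i) 1 - complex_of_real (exp (- (c i ^ 2) / 2))))"
  proof (rule norm_prod_diff)
    fix i assume "i \<in> I"
    then interpret D: real_distribution "D i"
      unfolding D_def by (intro real_distribution_distr) auto
    show "cmod (char (D i) 1) \<le> 1"
      by (rule D.cmod_char_le_1)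
  qed simp
  moreover have "\<dots> \<le> (\<Sum>i\<in>I. B * \<bar>c i\<bar> ^ 3 / 6 + c i ^ 4 / 8)"
  proof (rule sum_mono)
    fix i assume i: "i \<in> I"
    have "bounded_rv (Y i)"
      using Y i by (auto simp: bounded_rv_def)
    note int = bounded_rv_integrable[OF this] bounded_rv_integrable[OF bounded_rv_power[OF this]]
    have E0: "expectation (\<lambda>\<omega>. c i * Y i \<omega>) = 0" and E2: "expectation (\<lambda>\<omega>. (c i * Y i \<omega>) ^ 2) = c i ^ 2"
      using m1 m2 i by (auto simp: power_mult_distrib)
    have "cmod (char (D i) 1 - (1 - 1\<^sup>2 * c i ^ 2 / 2)) \<le> 1\<^sup>2 / 6 * expectation (\<lambda>\<omega>. min (6 * (c i * Y i \<omega>)\<^sup>2) (\<bar>1\<bar> * \<bar>c i * Y i \<omega>\<bar> ^ 3))"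
      using i int E0 E2 by (intro char_approx3') (auto simp: D_def power_mult_distrib)
    \<comment> \<open>The cubic branch of the minimum is kept, and one of its three factors
      \<open>\<bar>Y i \<omega>\<bar>\<close> is bounded by \<open>B\<close>; the remaining square
      has expectation 1.\<close>
    also have "\<dots> \<le> 1\<^sup>2 / 6 * expectation (\<lambda>\<omega>. B * \<bar>c i\<bar> ^ 3 * Y i \<omega> ^ 2)"
    proof (intro mult_left_mono integral_mono)
      show "integrable M (\<lambda>\<omega>. min (6 * (c i * Y i \<omega>)\<^sup>2) (\<bar>1\<bar> * \<bar>c i * Y i \<omega>\<bar> ^ 3))"
      proof (rule Bochner_Integration.integrable_bound)
        show "integrable M (\<lambda>\<omega>. 6 * c i ^ 2 * Y i \<omega> ^ 2)"
          using int by auto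
        show "AE \<omega> in M. norm (min (6 * (c i * Y i \<omega>)\<^sup>2) (\<bar>1\<bar> * \<bar>c i * Y i \<omega>\<bar> ^ 3)) \<le> norm (6 * c i ^ 2 * Y i \<omega> ^ 2)"
          by (intro AE_I2) (auto simp: power_mult_distrib)
      qed (use i in measurable)
      fix \<omega>
      have "\<bar>c i * Y i \<omega>\<bar> ^ 3 = \<bar>c i\<bar> ^ 3 * \<bar>Y i \<omega>\<bar> ^ 2 * \<bar>Y i \<omega>\<bar>"
        by (simp only: abs_mult power_mult_distrib power3_eq_cube power2_eq_square mult_ac)
      also have "\<dots> \<le> \<bar>c i\<bar> ^ 3 * \<bar>Y i \<omega>\<bar> ^ 2 * B"
        using Y(2)[OF i] by (intro mult_left_mono) auto
      finally show "min (6 * (c i * Y i \<omega>)\<^sup>2) (\<bar>1\<bar> * \<bar>c i * Y i \<omega>\<bar> ^ 3) \<le> B * \<bar>c i\<bar> ^ 3 * Y i \<omega> ^ 2"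
        by (simp add: min.coboundedI2 mult_ac)
    qed (use int in auto)
    also have "\<dots> = B * \<bar>c i\<bar> ^ 3 / 6"
      using m2[OF i] by simp
    finally have 1: "cmod (char (D i) 1 - complex_of_real (1 - c i ^ 2 / 2)) \<le> B * \<bar>c i\<bar> ^ 3 / 6"
      by simp
    have "\<bar>(1 - c i ^ 2 / 2) - exp (- (c i ^ 2 / 2))\<bar> \<le> (c i ^ 2 / 2) ^ 2 / 2"
      by (rule one_minus_exp_bound) simp
    then have 2: "cmod (complex_of_real (1 - c i ^ 2 / 2) - complex_of_real (exp (- (c i ^ 2) / 2))) \<le> c i ^ 4 / 8"
      unfolding of_real_diff[symmetric] norm_of_real by (simp add: power_divide)
    show "cmod (char (D i) 1 - complex_of_real (exp (- (c i ^ 2) / 2))) \<le> B * \<bar>c i\<bar> ^ 3 / 6 + c i ^ 4 / 8"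
      by (rule norm_diff_triangle_le[OF 1 2])
  qed
  ultimately show ?thesis
    by simp
qed

end

section \<open>Chain vectors as functions of the array of entries\<close>

text \<open>The triple \<open>(q, i, j)\<close> stands for the entry \<open>(i, j)\<close> of \<open>A\<^sup>(\<^sup>q\<^sup>)\<close>.\<close>

definition layer :: "(nat \<Rightarrow> nat) \<Rightarrow> nat \<Rightarrow> (nat \<times> nat \<times> nat) set" where
  "layer n q = {q} \<times> {..<n (q - 1)} \<times> {..<n q}"

definition entries :: "(nat \<Rightarrow> nat) \<Rightarrow> nat \<Rightarrow> (nat \<times> nat \<times> nat) set" where
  "entries n q = (\<Union>r\<in>{1..q}. layer n r)"

text \<open>The vector \<open>v\<^sub>q\<close> of the opening text, as a deterministic function of
  the array \<open>x\<close>, with \<open>f r\<close> applied to the entries of layer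
  \<open>r\<close>. Keeping \<open>f\<close> as a parameter places the original chain and its
  bounded replacement on the same entries, so that they can be compared in
  \<open>L\<^sup>2\<close>.\<close>

primrec chain_vec ::
    "(nat \<Rightarrow> nat) \<Rightarrow> (nat \<Rightarrow> real \<Rightarrow> real) \<Rightarrow> nat \<Rightarrow> nat \<Rightarrow> (nat \<times> nat \<times> nat \<Rightarrow> real) \<Rightarrow> real" where
  "chain_vec n f 0 j x = 1 / sqrt (n 0)"
| "chain_vec n f (Suc q) j x =
     (\<Sum>i<n q. chain_vec n f q i x * f (Suc q) (x (Suc q, i, j))) / sqrt (n (Suc q))"

definition chain_sqnorm ::
    "(nat \<Rightarrow> nat) \<Rightarrow> (nat \<Rightarrow> real \<Rightarrow> real) \<Rightarrow> nat \<Rightarrow> (nat \<times> nat \<times> nat \<Rightarrow> real) \<Rightarrow> real" where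
  "chain_sqnorm n f q x = (\<Sum>i<n q. chain_vec n f q i x ^ 2)"

lemma finite_layer [simp]: "finite (layer n q)"
  by (simp add: layer_def)

lemma layer_subset_entries: "1 \<le> r \<Longrightarrow> r \<le> q \<Longrightarrow> layer n r \<subseteq> entries n q"
  by (auto simp: entries_def)

lemma entries_mono: "q \<le> q' \<Longrightarrow> entries n q \<subseteq> entries n q'"
  unfolding entries_def by (intro UN_mono) auto

lemma entries_layer_disjoint: "entries n q \<inter> layer n (Suc q) = {}"
  by (auto simp: entries_def layer_def)

lemma mem_layer_iff [simp]: "(r, i, j) \<in> layer n q \<longleftrightarrow> r = q \<and> i < n (q - 1) \<and> j < n q"
  by (auto simp: layer_def)

lemma mem_entries_iff [simp]: "(r, i, j) \<in> entries n q \<longleftrightarrow> 1 \<le> r \<and> r \<le> q \<and> i < n (r - 1) \<and> j < n r"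
  by (auto simp: entries_def)

lemma sum_layer: "(\<Sum>t\<in>layer n (Suc q). h t) = (\<Sum>i<n q. \<Sum>j<n (Suc q). h (Suc q, i, j))"
  by (simp add: layer_def sum.cartesian_product')

text \<open>Lets the full array be replaced by its restriction to the past layers, which is the form
  in which independence from the next layer is available.\<close>

lemma chain_vec_cong:
  assumes "\<And>t. t \<in> entries n q \<Longrightarrow> x t = y t" "j < n q"
  shows "chain_vec n f q j x = chain_vec n f q j y"
  using assms
proof (induction q arbitrary: j)
  case (Suc q)
  have "chain_vec n f q i x = chain_vec n f q i y" if "i < n q" for i
    using Suc.IH[OF _ that] Suc.prems entries_mono[of q "Suc q" n] by auto
  moreover have "x (Suc q, i, j) = y (Suc q, i, j)" if "i < n q" for i
    using Suc.prems that by auto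
  ultimately show ?case by simp
qed simp

lemma chain_vec_measurable:
  assumes "\<And>r. r \<in> {1..q} \<Longrightarrow> f r \<in> borel_measurable borel" "j < n q" "entries n q \<subseteq> T"
  shows "chain_vec n f q j \<in> borel_measurable (PiM T (\<lambda>_. borel))"
  using assms
proof (induction q arbitrary: j)
  case (Suc q)
  have "chain_vec n f q i \<in> borel_measurable (PiM T (\<lambda>_. borel))" if "i < n q" for i
    using Suc.IH[OF _ that] Suc.prems entries_mono[of q "Suc q" n] by auto
  moreover have "(\<lambda>x. f (Suc q) (x (Suc q, i, j))) \<in> borel_measurable (PiM T (\<lambda>_. borel))" if "i < n q" for i
  proof (rule measurable_compose[OF measurable_component_singleton])
    show "(Suc q, i, j) \<in> T"
      using Suc.prems that by auto
  qed (use Suc.prems in auto)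
  moreover have "chain_vec n f (Suc q) j =
      (\<lambda>x. (\<Sum>i<n q. chain_vec n f q i x * f (Suc q) (x (Suc q, i, j))) / sqrt (n (Suc q)))"
    by (simp add: fun_eq_iff)
  ultimately show ?case by simp
qed (simp add: fun_eq_iff[of "chain_vec n f 0 j" "\<lambda>_. 1 / sqrt (n 0)" for j, THEN iffD2])

text \<open>The bound depends on the dimensions; it serves integrability and never enters an
  estimate.\<close>

lemma chain_vec_bounded:
  assumes "\<And>r x. r \<in> {1..q} \<Longrightarrow> \<bar>f r x\<bar> \<le> B"
  shows "\<exists>C. \<forall>x. \<bar>chain_vec n f q j x\<bar> \<le> C"
  using assms
proof (induction q arbitrary: j)
  case (Suc q)
  have "\<exists>C. \<forall>x. \<bar>chain_vec n f q i x\<bar> \<le> C" for i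
    by (rule Suc.IH) (use Suc.prems in auto)
  then obtain C where C: "\<And>i x. \<bar>chain_vec n f q i x\<bar> \<le> C i" by metis
  have "\<bar>chain_vec n f (Suc q) j x\<bar> \<le> (\<Sum>i<n q. C i * B) / sqrt (n (Suc q))" for x
  proof -
    have "\<bar>\<Sum>i<n q. chain_vec n f q i x * f (Suc q) (x (Suc q, i, j))\<bar> \<le> (\<Sum>i<n q. C i * B)"
    proof (rule order_trans[OF sum_abs], rule sum_mono)
      fix i
      have "0 \<le> C i"
        using C[of i x] abs_ge_zero order_trans by blast
      then show "\<bar>chain_vec n f q i x * f (Suc q) (x (Suc q, i, j))\<bar> \<le> C i * B"
        unfolding abs_mult using C Suc.prems by (intro mult_mono) auto
    qed
    then show ?thesis
      by (simp add: abs_divide divide_right_mono del: of_nat_Suc)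
  qed
  then show ?case by blast
qed auto

text \<open>Injectivity makes the singletons \<open>{h i}\<close> disjoint, so this is independence
  of blocks with one element each.\<close>

lemma (in prob_space) indep_vars_reindex:
  assumes ind: "indep_vars M' X (h ` I)" and "inj_on h I"
  shows "indep_vars (\<lambda>i. M' (h i)) (\<lambda>i. X (h i)) I"
proof -
  have "indep_vars (\<lambda>i. PiM {h i} M') (\<lambda>i \<omega>. restrict (\<lambda>t. X t \<omega>) {h i}) I"
    using ind by (rule indep_vars_restrict) (use \<open>inj_on h I\<close> in \<open>auto simp: disjoint_family_on_def inj_on_def\<close>)
  then have "indep_vars (\<lambda>i. M' (h i)) (\<lambda>i \<omega>. restrict (\<lambda>t. X t \<omega>) {h i} (h i)) I"
    by (rule indep_vars_compose2) (auto intro: measurable_component_singleton)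
  then show ?thesis by simp
qed

text \<open>This is nonnegativity of the variance of \<open>\<bar>Z \<omega>\<bar>\<close>.\<close>

lemma (in prob_space) expectation_abs_le_sqrt:
  fixes Z :: "'a \<Rightarrow> real"
  assumes Z: "Z \<in> borel_measurable M" "integrable M (\<lambda>\<omega>. Z \<omega> ^ 2)"
  shows "expectation (\<lambda>\<omega>. \<bar>Z \<omega>\<bar>) \<le> sqrt (expectation (\<lambda>\<omega>. Z \<omega> ^ 2))"
proof -
  have int: "integrable M (\<lambda>\<omega>. \<bar>Z \<omega>\<bar>)"
    using square_integrable_imp_integrable[OF Z] by auto
  have "0 \<le> variance (\<lambda>\<omega>. \<bar>Z \<omega>\<bar>)"
    by (rule variance_positive)
  also have "\<dots> = expectation (\<lambda>\<omega>. Z \<omega> ^ 2) - (expectation (\<lambda>\<omega>. \<bar>Z \<omega>\<bar>))\<^sup>2"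
    using int Z by (subst variance_eq) auto
  finally show ?thesis
    by (intro real_le_rsqrt) simp
qed

section \<open>Correlations of chains over an independent array\<close>

text \<open>The functions that may be applied to entries of law \<open>\<nu>\<close> while distinct
  paths stay uncorrelated. The identity and the bounded replacements will both be of this
  kind.\<close>

definition centered_L2 :: "real measure \<Rightarrow> (real \<Rightarrow> real) \<Rightarrow> bool" where
  "centered_L2 \<nu> f \<longleftrightarrow> f \<in> borel_measurable borel \<and> integrable \<nu> f \<and> integrable \<nu> (\<lambda>x. f x ^ 2) \<and>
     (\<integral>x. f x \<partial>\<nu>) = 0"

locale entry_array = prob_space M
  for M :: "'a measure" +
  fixes n :: "nat \<Rightarrow> nat" and p :: nat and X :: "nat \<times> nat \<times> nat \<Rightarrow> 'a \<Rightarrow> real"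
    and \<mu> :: "nat \<Rightarrow> real measure"
  assumes n_pos: "\<And>q. q \<le> p \<Longrightarrow> n q \<ge> 1"
    and indep: "indep_vars (\<lambda>_. borel) X (entries n p)"
    and law: "\<And>t. t \<in> entries n p \<Longrightarrow> distr M borel (X t) = \<mu> (fst t)"
begin

abbreviation "rvec f q j \<omega> \<equiv> chain_vec n f q j (\<lambda>t. X t \<omega>)"

lemma X_measurable: "t \<in> entries n p \<Longrightarrow> X t \<in> borel_measurable M"
  using indep by (auto simp: indep_vars_def)

text \<open>The input of \<open>expectation_decouple\<close>: what determines
  \<open>v\<^sub>q\<close> on one side, the layer that produces the next vector on the
  other.\<close>

lemma past_indep:
  assumes "Suc q \<le> p"
  shows "indep_var (PiM (entries n q) (\<lambda>_. borel)) (\<lambda>\<omega>. restrict (\<lambda>t. X t \<omega>) (entries n q))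
    (PiM (layer n (Suc q)) (\<lambda>_. borel)) (\<lambda>\<omega>. restrict (\<lambda>t. X t \<omega>) (layer n (Suc q)))"
  using indep
  by (rule indep_var_restrict)
    (use assms entries_mono[of q p n] layer_subset_entries[of "Suc q" p n] entries_layer_disjoint in auto)

lemma rvec_restrict:
  assumes "j < n q"
  shows "rvec f q j \<omega> = chain_vec n f q j (restrict (\<lambda>t. X t \<omega>) (entries n q))"
  using assms by (intro chain_vec_cong) auto

lemma
  assumes t: "t \<in> entries n p" and g: "g \<in> borel_measurable borel"
  shows expectation_entry: "expectation (\<lambda>\<omega>. g (X t \<omega>) :: real) = (\<integral>x. g x \<partial>\<mu> (fst t))"
    and integrable_entry: "integrable M (\<lambda>\<omega>. g (X t \<omega>)) \<longleftrightarrow> integrable (\<mu> (fst t)) g"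
  using X_measurable[OF t] g unfolding law[OF t, symmetric]
  by (simp_all add: integral_distr integrable_distr_eq)

lemma rvec_rv:
  assumes "\<And>r. r \<in> {1..p} \<Longrightarrow> f r \<in> borel_measurable borel" "q \<le> p" "j < n q"
  shows "(\<lambda>\<omega>. rvec f q j \<omega>) \<in> borel_measurable M"
proof -
  have "(\<lambda>\<omega>. restrict (\<lambda>t. X t \<omega>) (entries n q)) \<in> measurable M (PiM (entries n q) (\<lambda>_. borel))"
    using X_measurable entries_mono[OF \<open>q \<le> p\<close>, of n] by (intro measurable_restrict) blast
  moreover have "chain_vec n f q j \<in> borel_measurable (PiM (entries n q) (\<lambda>_. borel))"
    using assms by (intro chain_vec_measurable) auto
  ultimately have "(\<lambda>\<omega>. chain_vec n f q j (restrict (\<lambda>t. X t \<omega>) (entries n q))) \<in> borel_measurable M"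
    by (rule measurable_compose)
  then show ?thesis
    using assms(3) by (simp add: rvec_restrict[OF assms(3), symmetric])
qed

lemma entry_product:
  assumes s: "s \<in> layer n r" and t: "t \<in> layer n r" and r: "r \<in> {1..p}"
    and f: "centered_L2 (\<mu> r) f" and g: "centered_L2 (\<mu> r) g"
  shows "integrable M (\<lambda>\<omega>. f (X s \<omega>) * g (X t \<omega>)) \<and>
    expectation (\<lambda>\<omega>. f (X s \<omega>) * g (X t \<omega>)) = (if s = t then \<integral>x. f x * g x \<partial>\<mu> r else 0)"
proof -
  have st: "s \<in> entries n p" "t \<in> entries n p" and [simp]: "fst s = r" "fst t = r"
    using s t r layer_subset_entries[of r p n] by (auto simp: layer_def)
  note [measurable] = X_measurable[OF st(1)] X_measurable[OF st(2)]
  have [measurable]: "f \<in> borel_measurable borel" "g \<in> borel_measurable borel"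
    using f g by (auto simp: centered_L2_def)
  have int: "integrable M (\<lambda>\<omega>. f (X s \<omega>))" "integrable M (\<lambda>\<omega>. g (X t \<omega>))"
      "integrable M (\<lambda>\<omega>. f (X s \<omega>) ^ 2)" "integrable M (\<lambda>\<omega>. g (X t \<omega>) ^ 2)"
    and zero: "expectation (\<lambda>\<omega>. f (X s \<omega>)) = 0" "expectation (\<lambda>\<omega>. g (X t \<omega>)) = 0"
    using f g st by (simp_all add: centered_L2_def expectation_entry integrable_entry integrable_entry[where g="\<lambda>x. f x ^ 2"] integrable_entry[where g="\<lambda>x. g x ^ 2"])
  show ?thesis
  proof (cases "s = t")
    case True
    have *: "\<bar>a * b\<bar> \<le> \<bar>a ^ 2 + b ^ 2\<bar>" for a b :: real
    proof -
      have "0 \<le> \<bar>a * b\<bar>" "2 * \<bar>a * b\<bar> \<le> a ^ 2 + b ^ 2"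
        using sum_squares_bound[of "\<bar>a\<bar>" "\<bar>b\<bar>"] by (simp_all add: abs_mult mult.assoc)
      then show ?thesis by linarith
    qed
    have "integrable M (\<lambda>\<omega>. f (X s \<omega>) * g (X t \<omega>))"
      by (rule Bochner_Integration.integrable_bound[of _ "\<lambda>\<omega>. f (X s \<omega>) ^ 2 + g (X t \<omega>) ^ 2"])
        (use int * in \<open>auto intro!: AE_I2\<close>)
    then show ?thesis
      using True st expectation_entry[OF st(1), of "\<lambda>x. f x * g x"] by simp
  next
    case False
    have "indep_var borel ((\<lambda>x. f (x s)) \<circ> (\<lambda>\<omega>. restrict (\<lambda>i. X i \<omega>) {s}))
       borel ((\<lambda>x. g (x t)) \<circ> (\<lambda>\<omega>. restrict (\<lambda>i. X i \<omega>) {t}))"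
      using st False
      by (intro indep_var_compose[OF indep_var_restrict[OF indep]]) auto
    then have "indep_var borel (\<lambda>\<omega>. f (X s \<omega>)) borel (\<lambda>\<omega>. g (X t \<omega>))"
      by (simp add: comp_def)
    from indep_var_lebesgue_integral[OF this int(1,2)] indep_var_integrable[OF this int(1,2)] show ?thesis
      using False zero by simp
  qed
qed

text \<open>Uncorrelatedness of distinct paths, by induction on the layers. The new layer is
  independent of the past and contributes mean zero unless both the row and the column indices
  agree. The \<open>n q\<close> surviving terms each carry \<open>C / n q\<close>, so this dimension
  cancels and only the one-entry correlations accumulate. The case \<open>q = 0\<close> is
  exceptional because the coordinates of the constant vector are all fully correlated.\<close>

lemma rvec_correlation:
  assumes f: "\<And>r. r \<in> {1..p} \<Longrightarrow> centered_L2 (\<mu> r) (f r)"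
    and g: "\<And>r. r \<in> {1..p} \<Longrightarrow> centered_L2 (\<mu> r) (g r)"
    and "q \<le> p" "j < n q" "k < n q"
  shows "integrable M (\<lambda>\<omega>. rvec f q j \<omega> * rvec g q k \<omega>) \<and>
    expectation (\<lambda>\<omega>. rvec f q j \<omega> * rvec g q k \<omega>) =
      (if q = 0 \<or> j = k then (\<Prod>r=1..q. \<integral>x. f r x * g r x \<partial>\<mu> r) / n q else 0)"
  using assms(3-5)
proof (induction q arbitrary: j k)
  case 0
  then show ?case by (simp add: prob_space)
next
  case (Suc q)
  define c where "c = (\<integral>x. f (Suc q) x * g (Suc q) x \<partial>\<mu> (Suc q))"
  define C where "C = (\<Prod>r=1..q. \<integral>x. f r x * g r x \<partial>\<mu> r)"
  define U where "U = (\<lambda>i l \<omega>. rvec f q i \<omega> * rvec g q l \<omega>)"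
  define W where "W = (\<lambda>i l \<omega>. f (Suc q) (X (Suc q, i, j) \<omega>) * g (Suc q) (X (Suc q, l, k) \<omega>))"
  have meas: "f r \<in> borel_measurable borel" "g r \<in> borel_measurable borel" if "r \<in> {1..p}" for r
    using f[OF that] g[OF that] by (auto simp: centered_L2_def)
  \<comment> \<open>The value is recorded on the diagonal only: for \<open>i \<noteq> l\<close> the
    factor \<open>W i l\<close> has mean zero, whatever the mean of \<open>U i l\<close>. This lets
    \<open>q = 0\<close> be treated like the other cases.\<close>
  have U: "integrable M (U i l)" "i = l \<Longrightarrow> expectation (U i l) = C / n q" if "i < n q" "l < n q" for i l
    using Suc.IH[of i l] Suc.prems that by (auto simp: U_def C_def)
  have W: "integrable M (W i l)" "expectation (W i l) = (if i = l \<and> j = k then c else 0)" if "i < n q" "l < n q" for i l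
    using entry_product[of "(Suc q, i, j)" "Suc q" "(Suc q, l, k)" "f (Suc q)" "g (Suc q)"] f[of "Suc q"] g[of "Suc q"] Suc.prems that
    by (auto simp: W_def c_def)
  have UW: "integrable M (\<lambda>\<omega>. U i l \<omega> * W i l \<omega>)"
      "expectation (\<lambda>\<omega>. U i l \<omega> * W i l \<omega>) = (if i = l \<and> j = k then C * c / n q else 0)" if il: "i < n q" "l < n q" for i l
  proof -
    have [measurable]: "chain_vec n f q i \<in> borel_measurable (PiM (entries n q) (\<lambda>_. borel))"
        "chain_vec n g q l \<in> borel_measurable (PiM (entries n q) (\<lambda>_. borel))"
      using meas Suc.prems il by (auto intro!: chain_vec_measurable)
    have [measurable]: "f (Suc q) \<in> borel_measurable borel" "g (Suc q) \<in> borel_measurable borel"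
      using meas[of "Suc q"] Suc.prems by auto
    have in_layer [measurable]: "(Suc q, i, j) \<in> layer n (Suc q)" "(Suc q, l, k) \<in> layer n (Suc q)"
      using il Suc.prems by auto
    have "indep_var borel ((\<lambda>x. chain_vec n f q i x * chain_vec n g q l x) \<circ> (\<lambda>\<omega>. restrict (\<lambda>t. X t \<omega>) (entries n q)))
      borel ((\<lambda>x. f (Suc q) (x (Suc q, i, j)) * g (Suc q) (x (Suc q, l, k))) \<circ> (\<lambda>\<omega>. restrict (\<lambda>t. X t \<omega>) (layer n (Suc q))))"
      by (rule indep_var_compose[OF past_indep[OF Suc.prems(1)]]) measurable
    then have "indep_var borel (U i l) borel (W i l)"
      using il in_layer by (simp add: comp_def U_def[abs_def] W_def[abs_def] rvec_restrict)
    from indep_var_lebesgue_integral[OF this] indep_var_integrable[OF this] U[OF il] W[OF il]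
    show "integrable M (\<lambda>\<omega>. U i l \<omega> * W i l \<omega>)"
      "expectation (\<lambda>\<omega>. U i l \<omega> * W i l \<omega>) = (if i = l \<and> j = k then C * c / n q else 0)" 
      by auto
  qed
  have eq: "rvec f (Suc q) j \<omega> * rvec g (Suc q) k \<omega> = (\<Sum>i<n q. \<Sum>l<n q. U i l \<omega> * W i l \<omega>) / n (Suc q)" for \<omega>
    by (simp add: U_def W_def sum_product mult_ac del: of_nat_Suc)
  have int: "integrable M (\<lambda>\<omega>. \<Sum>l<n q. U i l \<omega> * W i l \<omega>)" if "i < n q" for i
    using UW(1) that by auto
  have "expectation (\<lambda>\<omega>. \<Sum>i<n q. \<Sum>l<n q. U i l \<omega> * W i l \<omega>)
      = (\<Sum>i<n q. expectation (\<lambda>\<omega>. \<Sum>l<n q. U i l \<omega> * W i l \<omega>))"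
    using int by (intro Bochner_Integration.integral_sum) auto
  also have "\<dots> = (\<Sum>i<n q. \<Sum>l<n q. expectation (\<lambda>\<omega>. U i l \<omega> * W i l \<omega>))"
    using UW(1) by (intro sum.cong refl Bochner_Integration.integral_sum) auto
  finally have "expectation (\<lambda>\<omega>. (\<Sum>i<n q. \<Sum>l<n q. U i l \<omega> * W i l \<omega>) / n (Suc q))
      = (\<Sum>i<n q. \<Sum>l<n q. if i = l \<and> j = k then C * c / n q else 0) / n (Suc q)"
    using UW(2) by (simp del: of_nat_Suc)
  also have "\<dots> = (if j = k then C * c / n (Suc q) else 0)"
    using n_pos[of q] Suc.prems by auto
  finally have "expectation (\<lambda>\<omega>. (\<Sum>i<n q. \<Sum>l<n q. U i l \<omega> * W i l \<omega>) / n (Suc q))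
      = (if j = k then C * c / n (Suc q) else 0)" .
  moreover have "integrable M (\<lambda>\<omega>. (\<Sum>i<n q. \<Sum>l<n q. U i l \<omega> * W i l \<omega>) / n (Suc q))"
    using UW(1) by (intro integrable_divide_zero Bochner_Integration.integrable_sum) auto
  ultimately show ?case
    unfolding eq by (simp add: C_def c_def del: of_nat_Suc)
qed

lemma chain_sqnorm_expectation:
  assumes f: "\<And>r. r \<in> {1..p} \<Longrightarrow> centered_L2 (\<mu> r) (f r)"
    and unit: "\<And>r. r \<in> {1..p} \<Longrightarrow> (\<integral>x. f r x ^ 2 \<partial>\<mu> r) = 1" and "q \<le> p"
  shows "integrable M (\<lambda>\<omega>. chain_sqnorm n f q (\<lambda>t. X t \<omega>))"
    and "expectation (\<lambda>\<omega>. chain_sqnorm n f q (\<lambda>t. X t \<omega>)) = 1"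
proof -
  have *: "integrable M (\<lambda>\<omega>. rvec f q i \<omega> ^ 2)" "expectation (\<lambda>\<omega>. rvec f q i \<omega> ^ 2) = 1 / n q" if "i < n q" for i
    using rvec_correlation[OF f f \<open>q \<le> p\<close> that that] unit \<open>q \<le> p\<close> by (simp_all add: power2_eq_square)
  then show "integrable M (\<lambda>\<omega>. chain_sqnorm n f q (\<lambda>t. X t \<omega>))"
    by (auto simp: chain_sqnorm_def)
  show "expectation (\<lambda>\<omega>. chain_sqnorm n f q (\<lambda>t. X t \<omega>)) = 1"
    unfolding chain_sqnorm_def using * n_pos[OF \<open>q \<le> p\<close>]
    by (subst Bochner_Integration.integral_sum) auto
qed

text \<open>The right-hand side is free of the dimensions, and this makes the truncation error
  uniform. Only the \<open>n p\<close> diagonal terms survive, each equal to \<open>C / n p\<close>;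
  \<open>p \<ge> 1\<close> excludes the constant initial vector.\<close>

lemma chain_sum_correlation:
  assumes f: "\<And>r. r \<in> {1..p} \<Longrightarrow> centered_L2 (\<mu> r) (f r)"
    and g: "\<And>r. r \<in> {1..p} \<Longrightarrow> centered_L2 (\<mu> r) (g r)" and "p \<ge> 1"
  shows "integrable M (\<lambda>\<omega>. (\<Sum>j<n p. rvec f p j \<omega>) * (\<Sum>j<n p. rvec g p j \<omega>))"
    and "expectation (\<lambda>\<omega>. (\<Sum>j<n p. rvec f p j \<omega>) * (\<Sum>j<n p. rvec g p j \<omega>)) =
      (\<Prod>r=1..p. \<integral>x. f r x * g r x \<partial>\<mu> r)"
proof -
  define C where "C = (\<Prod>r=1..p. \<integral>x. f r x * g r x \<partial>\<mu> r)"
  have *: "integrable M (\<lambda>\<omega>. rvec f p j \<omega> * rvec g p k \<omega>)"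
      "expectation (\<lambda>\<omega>. rvec f p j \<omega> * rvec g p k \<omega>) = (if j = k then C / n p else 0)"
    if "j < n p" "k < n p" for j k
    using rvec_correlation[OF f g order_refl that] \<open>p \<ge> 1\<close> by (simp_all add: C_def)
  have int: "integrable M (\<lambda>\<omega>. \<Sum>k<n p. rvec f p j \<omega> * rvec g p k \<omega>)" if "j < n p" for j
    using * that by auto
  then show "integrable M (\<lambda>\<omega>. (\<Sum>j<n p. rvec f p j \<omega>) * (\<Sum>j<n p. rvec g p j \<omega>))"
    unfolding sum_product by auto
  have "expectation (\<lambda>\<omega>. \<Sum>j<n p. \<Sum>k<n p. rvec f p j \<omega> * rvec g p k \<omega>)
      = (\<Sum>j<n p. expectation (\<lambda>\<omega>. \<Sum>k<n p. rvec f p j \<omega> * rvec g p k \<omega>))"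
    using int by (intro Bochner_Integration.integral_sum) auto
  also have "\<dots> = (\<Sum>j<n p. \<Sum>k<n p. expectation (\<lambda>\<omega>. rvec f p j \<omega> * rvec g p k \<omega>))"
    using * by (intro sum.cong refl Bochner_Integration.integral_sum) auto
  also have "\<dots> = C"
    using *(2) n_pos[of p] by simp
  finally show "expectation (\<lambda>\<omega>. (\<Sum>j<n p. rvec f p j \<omega>) * (\<Sum>j<n p. rvec g p j \<omega>)) = C"
    unfolding sum_product .
qed

section \<open>Concentration of the squared norms for bounded entries\<close>

lemma bounded_rv_entry:
  assumes "g \<in> borel_measurable borel" "\<And>x. \<bar>g x\<bar> \<le> B" "t \<in> entries n p"
  shows "bounded_rv (\<lambda>\<omega>. g (X t \<omega>))"
  using X_measurable[OF assms(3)] assms by (auto simp: bounded_rv_def)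

lemma bounded_rv_chain_sqnorm:
  assumes f: "\<And>r. r \<in> {1..p} \<Longrightarrow> f r \<in> borel_measurable borel"
    and B: "\<And>r x. r \<in> {1..p} \<Longrightarrow> \<bar>f r x\<bar> \<le> B" and "q \<le> p"
  shows "bounded_rv (\<lambda>\<omega>. chain_sqnorm n f q (\<lambda>t. X t \<omega>))"
proof -
  have "bounded_rv (\<lambda>\<omega>. rvec f q j \<omega>)" if "j < n q" for j
  proof -
    have "\<exists>C. \<forall>x. \<bar>chain_vec n f q j x\<bar> \<le> C"
      using B \<open>q \<le> p\<close> by (intro chain_vec_bounded[where B=B]) auto
    then show ?thesis
      using rvec_rv[OF f \<open>q \<le> p\<close> that] by (auto simp: bounded_rv_def)
  qed
  then show ?thesis
    unfolding chain_sqnorm_def by (intro bounded_rv_sum bounded_rv_power) auto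
qed

text \<open>With the past frozen by \<open>expectation_decouple\<close>, the new squared norm is the
  sum of squares of \<open>second_moment_sum_squares\<close> divided by \<open>n (Suc q)\<close>,
  with the coordinates of \<open>v\<^sub>q\<close> as weights.\<close>

lemma chain_sqnorm_second_moment_step:
  assumes f: "\<And>r. r \<in> {1..p} \<Longrightarrow> centered_L2 (\<mu> r) (f r)"
    and unit: "\<And>r. r \<in> {1..p} \<Longrightarrow> (\<integral>x. f r x ^ 2 \<partial>\<mu> r) = 1"
    and B: "\<And>r x. r \<in> {1..p} \<Longrightarrow> \<bar>f r x\<bar> \<le> B" and "Suc q \<le> p"
  shows "expectation (\<lambda>\<omega>. chain_sqnorm n f (Suc q) (\<lambda>t. X t \<omega>) ^ 2)
    \<le> (1 + (3 + B ^ 2) / n (Suc q)) * expectation (\<lambda>\<omega>. chain_sqnorm n f q (\<lambda>t. X t \<omega>) ^ 2)"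
proof -
  define r where "r = Suc q"
  define m where "m = real (n r)"
  define h where "h = f r"
  have r: "r \<in> {1..p}" and "1 \<le> r" "r \<le> p" and "q \<le> p"
    using \<open>Suc q \<le> p\<close> by (auto simp: r_def)
  have m: "m > 0"
    using n_pos[of r] \<open>r \<le> p\<close> by (simp add: m_def)
  have meas: "f r \<in> borel_measurable borel" if "r \<in> {1..p}" for r
    using f[OF that] by (simp add: centered_L2_def)
  have [measurable]: "h \<in> borel_measurable borel"
    using meas[OF r] by (simp add: h_def)
  \<comment> \<open>The past enters through \<open>x\<close> and the new layer through
    \<open>y\<close>; on the diagonal \<open>F\<close> is the squared norm to the power 2. The two
    arguments are what decoupling makes independent.\<close>
  define F where "F = (\<lambda>(x, y). ((\<Sum>j<n r. (\<Sum>i<n q. chain_vec n f q i x * h (y (r, i, j))) ^ 2) / m) ^ 2)"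
  have sq: "chain_sqnorm n f r x ^ 2 = F (x, x)" for x
    unfolding chain_sqnorm_def r_def chain_vec.simps
    by (simp add: F_def r_def h_def m_def power_divide sum_divide_distrib[symmetric] del: of_nat_Suc)
  have F_eq: "F (x, y) = F (restrict x (entries n q), restrict y (layer n r))" for x y
  proof -
    have "chain_vec n f q i (restrict x (entries n q)) = chain_vec n f q i x" if "i < n q" for i
      using that by (intro chain_vec_cong) auto
    then show ?thesis
      by (simp add: F_def r_def cong: sum.cong_simp)
  qed
  have F: "F \<in> borel_measurable (PiM (entries n q) (\<lambda>_. borel) \<Otimes>\<^sub>M PiM (layer n r) (\<lambda>_. borel))"
  proof -
    have [measurable]: "chain_vec n f q i \<in> borel_measurable (PiM (entries n q) (\<lambda>_. borel))" if "i < n q" for i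
      using meas \<open>q \<le> p\<close> that by (intro chain_vec_measurable) auto
    have [measurable]: "i < n q \<Longrightarrow> j < n r \<Longrightarrow> (r, i, j) \<in> layer n r" for i j
      by (simp add: r_def)
    show ?thesis
      unfolding F_def by measurable
  qed
  have bdd: "bounded_rv (\<lambda>\<omega>. chain_sqnorm n f s (\<lambda>t. X t \<omega>))" if "s \<le> p" for s
    by (rule bounded_rv_chain_sqnorm[where B=B]) (use meas B that in auto)
  have "integrable M (\<lambda>\<omega>. chain_sqnorm n f r (\<lambda>t. X t \<omega>) ^ 2)"
    using bdd[OF \<open>r \<le> p\<close>] by (auto intro: bounded_rv_integrable)
  then have int: "integrable M (\<lambda>\<omega>. F (restrict (\<lambda>t. X t \<omega>) (entries n q), restrict (\<lambda>t. X t \<omega>) (layer n r)))"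
    by (simp add: F_eq[symmetric] sq)
  note dec = expectation_decouple[OF past_indep[OF \<open>Suc q \<le> p\<close>], folded r_def, OF F int]
  have inner: "expectation (\<lambda>\<omega>'. F (x, \<lambda>t. X t \<omega>')) \<le> (1 + (3 + B ^ 2) / m) * chain_sqnorm n f q x ^ 2" for x
  proof -
    define Y where "Y = (\<lambda>(i, j) \<omega>. h (X (r, i, j) \<omega>))"
    have ent: "(r, i, j) \<in> entries n p" if "i < n q" "j < n r" for i j
      using r that by (auto simp: r_def)
    have lay: "(r, i, j) \<in> layer n r" if "i < n q" "j < n r" for i j
      using that by (auto simp: r_def)
    have "indep_vars (\<lambda>_. borel) X (Pair r ` ({..<n q} \<times> {..<n r}))"
      using indep by (rule indep_vars_subset) (use ent in auto)
    then have "indep_vars (\<lambda>_. borel) (\<lambda>i. X (r, i)) ({..<n q} \<times> {..<n r})"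
      by (rule indep_vars_reindex) (auto simp: inj_on_def)
    then have "indep_vars (\<lambda>_. borel) (\<lambda>i \<omega>. h (X (r, i) \<omega>)) ({..<n q} \<times> {..<n r})"
      by (rule indep_vars_compose2) auto
    then have indY: "indep_vars (\<lambda>_. borel) Y ({..<n q} \<times> {..<n r})"
      by (simp add: Y_def case_prod_beta' del: split_paired_All)
    have bY: "bounded_rv (Y t)" if "t \<in> {..<n q} \<times> {..<n r}" for t
      using that ent B[OF r] unfolding Y_def h_def[symmetric] by (auto intro!: bounded_rv_entry[where B=B])
    have m1: "expectation (Y t) = 0" if "t \<in> {..<n q} \<times> {..<n r}" for t
      using that ent f[OF r] unfolding Y_def h_def[symmetric]
      by (auto simp: centered_L2_def expectation_entry)
    have m2: "expectation (\<lambda>\<omega>. Y t \<omega> ^ 2) = 1" if "t \<in> {..<n q} \<times> {..<n r}" for t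
      using that ent unit[OF r] unfolding Y_def h_def[symmetric]
      by (auto simp: expectation_entry[where g="\<lambda>x. h x ^ 2"])
    \<comment> \<open>Unit variance and the bound \<open>B\<close> already give
      \<open>B ^ 2\<close>; the summand 3 secures the requirement \<open>3 \<le> K\<close> of
      \<open>second_moment_sum_squares\<close>.\<close>
    have m4: "expectation (\<lambda>\<omega>. Y t \<omega> ^ 4) \<le> 3 + B ^ 2" if t: "t \<in> {..<n q} \<times> {..<n r}" for t
    proof -
      have "expectation (\<lambda>\<omega>. Y t \<omega> ^ 4) \<le> expectation (\<lambda>\<omega>. B ^ 2 * Y t \<omega> ^ 2)"
      proof (rule integral_mono)
        fix \<omega>
        have "\<bar>Y t \<omega>\<bar> ^ 2 \<le> B ^ 2"
          using B[OF r] by (intro power_mono) (auto simp: Y_def h_def split: prod.split)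
        then have "Y t \<omega> ^ 2 * Y t \<omega> ^ 2 \<le> B ^ 2 * Y t \<omega> ^ 2"
          by (intro mult_right_mono) auto
        then show "Y t \<omega> ^ 4 \<le> B ^ 2 * Y t \<omega> ^ 2"
          by (simp flip: power_add)
      qed (use bY[OF t] in \<open>auto intro!: bounded_rv_integrable\<close>)
      also have "\<dots> = B ^ 2"
        using m2[OF t] by simp
      finally show ?thesis by simp
    qed
    have "expectation (\<lambda>\<omega>'. F (x, \<lambda>t. X t \<omega>')) =
      expectation (\<lambda>\<omega>. (\<Sum>j\<in>{..<n r}. (\<Sum>i\<in>{..<n q}. chain_vec n f q i x * Y (i, j) \<omega>) ^ 2) ^ 2) / m ^ 2"
      by (simp add: F_def Y_def power_divide)
    also have "\<dots> \<le> (card {..<n r} ^ 2 + (3 + B ^ 2) * card {..<n r}) * (\<Sum>i\<in>{..<n q}. chain_vec n f q i x ^ 2) ^ 2 / m ^ 2"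
      by (intro divide_right_mono second_moment_sum_squares indY bY m1 m2 m4) auto
    also have "\<dots> = (1 + (3 + B ^ 2) / m) * chain_sqnorm n f q x ^ 2"
      using m by (simp add: chain_sqnorm_def field_simps power2_eq_square flip: m_def)
    finally show ?thesis .
  qed
  have "expectation (\<lambda>\<omega>. chain_sqnorm n f r (\<lambda>t. X t \<omega>) ^ 2) =
      expectation (\<lambda>\<omega>. F (restrict (\<lambda>t. X t \<omega>) (entries n q), restrict (\<lambda>t. X t \<omega>) (layer n r)))"
    by (simp add: F_eq[symmetric] sq)
  also have "\<dots> = expectation (\<lambda>\<omega>. expectation (\<lambda>\<omega>'. F (\<lambda>t. X t \<omega>, \<lambda>t. X t \<omega>')))"
    unfolding dec(2) by (simp add: F_eq[symmetric])
  also have "\<dots> \<le> expectation (\<lambda>\<omega>. (1 + (3 + B ^ 2) / m) * chain_sqnorm n f q (\<lambda>t. X t \<omega>) ^ 2)"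
  proof (rule integral_mono)
    show "integrable M (\<lambda>\<omega>. expectation (\<lambda>\<omega>'. F (\<lambda>t. X t \<omega>, \<lambda>t. X t \<omega>')))"
      using dec(1) by (simp add: F_eq[symmetric])
    show "integrable M (\<lambda>\<omega>. (1 + (3 + B ^ 2) / m) * chain_sqnorm n f q (\<lambda>t. X t \<omega>) ^ 2)"
      using bdd[OF \<open>q \<le> p\<close>] by (auto intro!: bounded_rv_integrable)
  qed (rule inner)
  finally show ?thesis
    by (simp add: r_def m_def)
qed

text \<open>The squared norm starts at 1 and keeps mean 1, so its variance is at most this product
  minus 1, which tends to 0 when \<open>B\<close> is fixed and the dimensions grow.\<close>

lemma chain_sqnorm_second_moment:
  assumes f: "\<And>r. r \<in> {1..p} \<Longrightarrow> centered_L2 (\<mu> r) (f r)"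
    and unit: "\<And>r. r \<in> {1..p} \<Longrightarrow> (\<integral>x. f r x ^ 2 \<partial>\<mu> r) = 1"
    and B: "\<And>r x. r \<in> {1..p} \<Longrightarrow> \<bar>f r x\<bar> \<le> B" and "q \<le> p"
  shows "expectation (\<lambda>\<omega>. chain_sqnorm n f q (\<lambda>t. X t \<omega>) ^ 2) \<le> (\<Prod>r=1..q. 1 + (3 + B ^ 2) / n r)"
  using \<open>q \<le> p\<close>
proof (induction q)
  case 0
  have "chain_sqnorm n f 0 x = 1" for x
    using n_pos[of 0] by (simp add: chain_sqnorm_def power_divide)
  then show ?case
    by (simp add: prob_space)
next
  case (Suc q)
  have "expectation (\<lambda>\<omega>. chain_sqnorm n f (Suc q) (\<lambda>t. X t \<omega>) ^ 2)
    \<le> (1 + (3 + B ^ 2) / n (Suc q)) * expectation (\<lambda>\<omega>. chain_sqnorm n f q (\<lambda>t. X t \<omega>) ^ 2)"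
    by (rule chain_sqnorm_second_moment_step) (use f unit B Suc.prems in auto)
  also have "\<dots> \<le> (1 + (3 + B ^ 2) / n (Suc q)) * (\<Prod>r=1..q. 1 + (3 + B ^ 2) / n r)"
    using Suc by (intro mult_left_mono add_nonneg_nonneg) auto
  finally show ?case
    by (simp add: mult.commute)
qed

section \<open>Conditional Gaussian approximation of the chain sum\<close>

text \<open>Two comparisons. With \<open>v\<^sub>q\<close> frozen, the sum is a linear form in the
  last layer and nearly Gaussian of variance \<open>N\<close>, the squared norm of
  \<open>v\<^sub>q\<close>; averaging this error gives the first two terms. Replacing the random
  variance \<open>N\<close> by 1 gives the third.\<close>

lemma chain_sum_char_bound:
  assumes f: "\<And>r. r \<in> {1..p} \<Longrightarrow> centered_L2 (\<mu> r) (f r)"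
    and unit: "\<And>r. r \<in> {1..p} \<Longrightarrow> (\<integral>x. f r x ^ 2 \<partial>\<mu> r) = 1"
    and B: "\<And>r x. r \<in> {1..p} \<Longrightarrow> \<bar>f r x\<bar> \<le> B" and p: "p = Suc q"
  defines "D \<equiv> (\<Prod>r=1..q. 1 + (3 + B ^ 2) / n r)"
  shows "cmod (expectation (\<lambda>\<omega>. iexp (t * (\<Sum>j<n p. rvec f p j \<omega>))) - exp (- (t ^ 2) / 2))
    \<le> B * \<bar>t\<bar> ^ 3 * (1 + D) / (6 * sqrt (n p)) + t ^ 4 * D / (8 * real (n p)) + t ^ 2 / 2 * sqrt (D - 1)"
proof -
  define m where "m = real (n p)"
  define h where "h = f p"
  have pp: "p \<in> {1..p}" and "q \<le> p" and "Suc q \<le> p"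
    using p by auto
  have m: "m > 0"
    using n_pos[of p] by (simp add: m_def)
  have "B \<ge> 0"
    using B[OF pp, of 0] by linarith
  have meas: "f r \<in> borel_measurable borel" if "r \<in> {1..p}" for r
    using f[OF that] by (simp add: centered_L2_def)
  have [measurable]: "h \<in> borel_measurable borel"
    using meas[OF pp] by (simp add: h_def)
  define N where "N = (\<lambda>\<omega>. chain_sqnorm n f q (\<lambda>t. X t \<omega>))"
  \<comment> \<open>The weight of the entry \<open>s\<close> depends on its row
    \<open>fst (snd s)\<close> only, so each weight occurs once in each of the \<open>m\<close>
    columns.\<close>
  define c where "c = (\<lambda>x (s :: nat \<times> nat \<times> nat). t * chain_vec n f q (fst (snd s)) x / sqrt m)"
  define F where "F = (\<lambda>(x, y). iexp (\<Sum>s\<in>layer n p. c x s * h (y s)))"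
  have S: "iexp (t * (\<Sum>j<n p. chain_vec n f p j x)) = F (x, x)" for x
  proof -
    have "t * (\<Sum>j<n p. chain_vec n f p j x) = (\<Sum>j<n p. \<Sum>i<n q. c x (p, i, j) * h (x (p, i, j)))"
      unfolding p chain_vec.simps
      by (simp add: c_def h_def m_def p sum_distrib_left sum_divide_distrib mult_ac del: of_nat_Suc)
    also have "\<dots> = (\<Sum>s\<in>layer n p. c x s * h (x s))"
      unfolding p sum_layer by (rule sum.swap)
    finally show ?thesis
      by (simp add: F_def)
  qed
  have F_eq: "F (x, y) = F (restrict x (entries n q), restrict y (layer n p))" for x y
  proof -
    have "chain_vec n f q i (restrict x (entries n q)) = chain_vec n f q i x" if "i < n q" for i
      using that by (intro chain_vec_cong) auto
    then have "c (restrict x (entries n q)) s * h (restrict y (layer n p) s) = c x s * h (y s)" if "s \<in> layer n p" for s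
      using that by (auto simp: c_def p layer_def)
    then have "(\<Sum>s\<in>layer n p. c (restrict x (entries n q)) s * h (restrict y (layer n p) s)) =
        (\<Sum>s\<in>layer n p. c x s * h (y s))"
      by (rule sum.cong[OF refl])
    then show ?thesis
      unfolding F_def prod.case by simp
  qed
  have F: "F \<in> borel_measurable (PiM (entries n q) (\<lambda>_. borel) \<Otimes>\<^sub>M PiM (layer n p) (\<lambda>_. borel))"
  proof -
    have [measurable]: "(\<lambda>x. c x s) \<in> borel_measurable (PiM (entries n q) (\<lambda>_. borel))" if "s \<in> layer n p" for s
    proof -
      have [measurable]: "chain_vec n f q (fst (snd s)) \<in> borel_measurable (PiM (entries n q) (\<lambda>_. borel))"
        using meas \<open>q \<le> p\<close> that by (intro chain_vec_measurable) (auto simp: layer_def p)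
      show ?thesis unfolding c_def by measurable
    qed
    show ?thesis
      unfolding F_def by measurable
  qed
  have rv: "(\<lambda>\<omega>. \<Sum>j<n p. rvec f p j \<omega>) \<in> borel_measurable M"
    using rvec_rv[OF meas order_refl] by (intro borel_measurable_sum) auto
  have "(\<lambda>s. iexp (t * s)) \<in> borel_measurable borel"
    by measurable
  from measurable_compose[OF rv this] have "integrable M (\<lambda>\<omega>. iexp (t * (\<Sum>j<n p. rvec f p j \<omega>)))"
    by (intro integrable_const_bound[where B=1]) (auto simp del: of_real_sum of_real_mult)
  then have int: "integrable M (\<lambda>\<omega>. F (restrict (\<lambda>t. X t \<omega>) (entries n q), restrict (\<lambda>t. X t \<omega>) (layer n p)))"
    by (simp only: F_eq[symmetric] S)
  note dec = expectation_decouple[OF past_indep[OF \<open>Suc q \<le> p\<close>], folded p, OF F int]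
  define G where "G = (\<lambda>\<omega>. expectation (\<lambda>\<omega>'. F (\<lambda>t. X t \<omega>, \<lambda>t. X t \<omega>')))"
  have G: "integrable M G" "expectation (\<lambda>\<omega>. iexp (t * (\<Sum>j<n p. rvec f p j \<omega>))) = expectation G"
    using dec by (simp_all only: G_def F_eq[symmetric] S)
  define e where "e = (\<lambda>\<omega>. B * \<bar>t\<bar> ^ 3 / (6 * sqrt m) * (1 + N \<omega> ^ 2) + t ^ 4 / (8 * m) * N \<omega> ^ 2)"
  have inner: "cmod (G \<omega> - exp (- (t ^ 2 * N \<omega>) / 2)) \<le> e \<omega>" for \<omega>
  proof -
    define x where "x = (\<lambda>t. X t \<omega>)"
    have ent: "s \<in> entries n p" if "s \<in> layer n p" for s
      using that layer_subset_entries[of p p n] p by auto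
    have fst: "fst s = p" if "s \<in> layer n p" for s
      using that by (auto simp: layer_def)
    have "indep_vars (\<lambda>_. borel) X (layer n p)"
      using indep by (rule indep_vars_subset) (use ent in auto)
    then have indY: "indep_vars (\<lambda>_. borel) (\<lambda>s \<omega>. h (X s \<omega>)) (layer n p)"
      by (rule indep_vars_compose2) auto
    \<comment> \<open>The factor \<open>m\<close> meets the powers of \<open>sqrt m\<close> in the
      weights: it cancels in the sum of squares and leaves \<open>1 / sqrt m\<close> for cubes and
      \<open>1 / m\<close> for fourth powers.\<close>
    have sum_h: "(\<Sum>s\<in>layer n p. g (chain_vec n f q (fst (snd s)) x)) = m * (\<Sum>i<n q. g (chain_vec n f q i x))"
      for g :: "real \<Rightarrow> real"
      unfolding p sum_layer by (simp add: m_def p sum_distrib_left)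
    have N: "N \<omega> = (\<Sum>i<n q. chain_vec n f q i x ^ 2)"
      by (simp add: N_def chain_sqnorm_def x_def)
    have N0: "0 \<le> N \<omega>"
      unfolding N by (intro sum_nonneg) auto
    have le: "chain_vec n f q i x ^ 2 \<le> N \<omega>" if "i < n q" for i
      unfolding N using that by (intro member_le_sum) auto
    have sum2: "(\<Sum>s\<in>layer n p. c x s ^ 2) = t ^ 2 * N \<omega>"
      using sum_h[of "\<lambda>v. (t * v / sqrt m) ^ 2"] m
      by (simp add: c_def N power_divide power_mult_distrib sum_distrib_left[symmetric] sum_divide_distrib[symmetric])
    \<comment> \<open>One factor \<open>\<bar>v\<bar>\<close> is bounded by half of
      \<open>1 + v ^ 2\<close>. The aim is a bound on the cubes by
      \<open>1 + N \<omega> ^ 2\<close>, whose expectation is controlled by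
      \<open>D\<close>.\<close>
    have "\<bar>v\<bar> ^ 3 \<le> v ^ 2 * (1 + N \<omega>) / 2" if "v ^ 2 \<le> N \<omega>" for v :: real
    proof -
      have "2 * \<bar>v\<bar> \<le> 1 + v ^ 2"
        using sum_squares_bound[of 1 "\<bar>v\<bar>"] by simp
      then have "2 * \<bar>v\<bar> \<le> 1 + N \<omega>"
        using that by linarith
      then have "v ^ 2 * (2 * \<bar>v\<bar>) \<le> v ^ 2 * (1 + N \<omega>)"
        by (rule mult_left_mono) auto
      moreover have "\<bar>v\<bar> ^ 3 = v ^ 2 * \<bar>v\<bar>"
        by (simp add: power3_eq_cube power2_eq_square abs_mult_self_eq flip: mult.assoc)
      ultimately show ?thesis by simp
    qed
    then have "(\<Sum>i<n q. \<bar>chain_vec n f q i x\<bar> ^ 3) \<le> (\<Sum>i<n q. chain_vec n f q i x ^ 2 * ((1 + N \<omega>) / 2))"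
      using le by (intro sum_mono) simp
    also have "\<dots> = N \<omega> * (1 + N \<omega>) / 2"
      unfolding sum_distrib_right[symmetric] by (simp add: N)
    also have "\<dots> \<le> 1 + N \<omega> ^ 2"
      using sum_squares_bound[of 1 "N \<omega>"] zero_le_square[of "N \<omega>"]
      by (simp add: power2_eq_square algebra_simps del: zero_le_square)
    finally have sum3': "(\<Sum>i<n q. \<bar>chain_vec n f q i x\<bar> ^ 3) \<le> 1 + N \<omega> ^ 2" .
    have "(\<Sum>i<n q. chain_vec n f q i x ^ 4) \<le> (\<Sum>i<n q. chain_vec n f q i x ^ 2 * N \<omega>)"
    proof (intro sum_mono)
      fix i assume "i \<in> {..<n q}"
      then have "chain_vec n f q i x ^ 2 * chain_vec n f q i x ^ 2 \<le> chain_vec n f q i x ^ 2 * N \<omega>"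
        by (intro mult_left_mono le) auto
      then show "chain_vec n f q i x ^ 4 \<le> chain_vec n f q i x ^ 2 * N \<omega>"
        by (simp flip: power_add)
    qed
    also have "\<dots> = N \<omega> ^ 2"
      unfolding sum_distrib_right[symmetric] by (simp add: N power2_eq_square)
    finally have sum4': "(\<Sum>i<n q. chain_vec n f q i x ^ 4) \<le> N \<omega> ^ 2" .
    have sq3: "sqrt m ^ 3 = m * sqrt m" and sq4: "sqrt m ^ 4 = m ^ 2"
      using m by (simp_all add: power3_eq_cube power4_eq_xxxx power2_eq_square)
    have "(\<Sum>s\<in>layer n p. \<bar>c x s\<bar> ^ 3) = \<bar>t\<bar> ^ 3 / sqrt m * (\<Sum>i<n q. \<bar>chain_vec n f q i x\<bar> ^ 3)"
      using sum_h[of "\<lambda>v. \<bar>t * v / sqrt m\<bar> ^ 3"] m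
      by (simp add: c_def abs_mult abs_divide power_divide power_mult_distrib sq3 sum_distrib_left[symmetric] sum_divide_distrib[symmetric])
    also have "\<dots> \<le> \<bar>t\<bar> ^ 3 / sqrt m * (1 + N \<omega> ^ 2)"
      using m by (intro mult_left_mono sum3') auto
    finally have sum3: "(\<Sum>s\<in>layer n p. \<bar>c x s\<bar> ^ 3) \<le> \<bar>t\<bar> ^ 3 / sqrt m * (1 + N \<omega> ^ 2)" .
    have "(\<Sum>s\<in>layer n p. c x s ^ 4) = t ^ 4 / m * (\<Sum>i<n q. chain_vec n f q i x ^ 4)"
      using sum_h[of "\<lambda>v. (t * v / sqrt m) ^ 4"] m
      by (simp add: c_def power_divide power_mult_distrib sq4 sum_distrib_left[symmetric] sum_divide_distrib[symmetric] power2_eq_square)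
    also have "\<dots> \<le> t ^ 4 / m * N \<omega> ^ 2"
      using m by (intro mult_left_mono sum4') auto
    finally have sum4: "(\<Sum>s\<in>layer n p. c x s ^ 4) \<le> t ^ 4 / m * N \<omega> ^ 2" .
    have "cmod (G \<omega> - exp (- (t ^ 2 * N \<omega>) / 2)) =
      cmod (expectation (\<lambda>\<omega>. iexp (\<Sum>s\<in>layer n p. c x s * h (X s \<omega>))) - exp (- (\<Sum>s\<in>layer n p. c x s ^ 2) / 2))"
      unfolding sum2 by (simp add: G_def F_def x_def)
    also have "\<dots> \<le> (\<Sum>s\<in>layer n p. B * \<bar>c x s\<bar> ^ 3 / 6 + c x s ^ 4 / 8)"
    proof (rule char_weighted_sum_approx[OF finite_layer indY])
      fix s assume s: "s \<in> layer n p"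
      show "(\<lambda>\<omega>. h (X s \<omega>)) \<in> borel_measurable M"
        using X_measurable[OF ent[OF s]] by measurable
      show "expectation (\<lambda>\<omega>. h (X s \<omega>)) = 0" "expectation (\<lambda>\<omega>. (h (X s \<omega>))\<^sup>2) = 1"
        using f[OF pp] unit[OF pp] expectation_entry[OF ent[OF s], of h] expectation_entry[OF ent[OF s], of "\<lambda>x. h x ^ 2"]
          \<open>h \<in> borel_measurable borel\<close> borel_measurable_power[OF \<open>h \<in> borel_measurable borel\<close>, of 2]
        by (simp_all add: fst[OF s] centered_L2_def flip: h_def)
      show "\<bar>h (X s \<omega>)\<bar> \<le> B" for \<omega>
        using B[OF pp] by (simp add: h_def)
    qed
    also have "\<dots> = B * (\<Sum>s\<in>layer n p. \<bar>c x s\<bar> ^ 3) / 6 + (\<Sum>s\<in>layer n p. c x s ^ 4) / 8"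
      by (simp add: sum.distrib sum_distrib_left sum_divide_distrib)
    also have "\<dots> \<le> B * (\<bar>t\<bar> ^ 3 / sqrt m * (1 + N \<omega> ^ 2)) / 6 + t ^ 4 / m * N \<omega> ^ 2 / 8"
      using \<open>B \<ge> 0\<close> by (intro add_mono divide_right_mono mult_left_mono sum3 sum4) auto
    also have "\<dots> = e \<omega>"
      by (simp add: e_def mult.assoc)
    finally show ?thesis .
  qed
  have bN: "bounded_rv N"
    unfolding N_def using meas B \<open>q \<le> p\<close> by (rule bounded_rv_chain_sqnorm)
  have N0: "0 \<le> N \<omega>" for \<omega>
    by (auto simp: N_def chain_sqnorm_def intro: sum_nonneg)
  have EN: "expectation N = 1" and EN2: "expectation (\<lambda>\<omega>. N \<omega> ^ 2) \<le> D"
    unfolding N_def D_def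
    using chain_sqnorm_expectation(2)[OF f unit \<open>q \<le> p\<close>] chain_sqnorm_second_moment[OF f unit B \<open>q \<le> p\<close>] by auto
  have iN [simp]: "integrable M N" "integrable M (\<lambda>\<omega>. N \<omega> ^ 2)"
    using bN by (auto intro: bounded_rv_integrable)
  have [measurable]: "N \<in> borel_measurable M"
    using bN by (rule bounded_rv_measurable)
  have gauss: "integrable M (\<lambda>\<omega>. complex_of_real (exp (- (t ^ 2 * N \<omega>) / 2)))"
    by (intro integrable_const_bound[where B=1]) (auto simp: N0)
  have "cmod (expectation G - expectation (\<lambda>\<omega>. complex_of_real (exp (- (t ^ 2 * N \<omega>) / 2)))) \<le> expectation e"
  proof -
    have "cmod (expectation (\<lambda>\<omega>. G \<omega> - exp (- (t ^ 2 * N \<omega>) / 2))) \<le> expectation (\<lambda>\<omega>. cmod (G \<omega> - exp (- (t ^ 2 * N \<omega>) / 2)))"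
      by (rule integral_norm_bound)
    also have "\<dots> \<le> expectation e"
      using inner G(1) gauss by (intro integral_mono) (auto simp: e_def)
    finally show ?thesis
      using G(1) gauss by simp
  qed
  also have "expectation e = B * \<bar>t\<bar> ^ 3 / (6 * sqrt m) * (1 + expectation (\<lambda>\<omega>. N \<omega> ^ 2)) + t ^ 4 / (8 * m) * expectation (\<lambda>\<omega>. N \<omega> ^ 2)"
    by (simp add: e_def prob_space)
  also have "\<dots> \<le> B * \<bar>t\<bar> ^ 3 / (6 * sqrt m) * (1 + D) + t ^ 4 / (8 * m) * D"
    using \<open>B \<ge> 0\<close> m by (intro add_mono mult_left_mono EN2 order_refl) auto
  finally have 1: "cmod (expectation G - expectation (\<lambda>\<omega>. complex_of_real (exp (- (t ^ 2 * N \<omega>) / 2))))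
      \<le> B * \<bar>t\<bar> ^ 3 / (6 * sqrt m) * (1 + D) + t ^ 4 / (8 * m) * D" .
  have lip: "\<bar>exp (- a) - exp (- b)\<bar> \<le> \<bar>a - b\<bar>" if "a \<ge> 0" "b \<ge> 0" for a b :: real
  proof -
    have *: "exp (- a) - exp (- b) \<le> b - a" if "a \<ge> 0" "a \<le> b" for a b :: real
    proof -
      have "exp (- a) - exp (- b) = exp (- a) * (1 - exp (- (b - a)))"
        by (simp add: algebra_simps flip: exp_add)
      also have "\<dots> \<le> 1 * (b - a)"
      proof (rule mult_mono)
        show "1 - exp (- (b - a)) \<le> b - a"
          using exp_ge_add_one_self[of "- (b - a)"] by linarith
      qed (use that in auto)
      finally show ?thesis by simp
    qed
    show ?thesis
      using *[of a b] *[of b a] that by (cases "a \<le> b") (auto simp: abs_if)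
  qed
  \<comment> \<open>Second comparison: \<open>exp\<close> of a negated argument is 1-Lipschitz on
    the nonnegative reals, which reduces it to the mean of
    \<open>\<bar>N \<omega> - 1\<bar>\<close>. As \<open>N\<close> has mean 1, that is at most the
    root of its variance.\<close>
  have "cmod (expectation (\<lambda>\<omega>. complex_of_real (exp (- (t ^ 2 * N \<omega>) / 2))) - exp (- (t ^ 2) / 2))
      = cmod (expectation (\<lambda>\<omega>. complex_of_real (exp (- (t ^ 2 * N \<omega>) / 2)) - exp (- (t ^ 2) / 2)))"
    using gauss by (simp add: prob_space)
  also have "\<dots> \<le> expectation (\<lambda>\<omega>. cmod (complex_of_real (exp (- (t ^ 2 * N \<omega>) / 2)) - exp (- (t ^ 2) / 2)))"
    by (rule integral_norm_bound)
  also have "\<dots> \<le> expectation (\<lambda>\<omega>. t ^ 2 / 2 * \<bar>N \<omega> - 1\<bar>)"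
  proof (rule integral_mono)
    fix \<omega>
    have "\<bar>exp (- (t ^ 2 * N \<omega> / 2)) - exp (- (t ^ 2 / 2))\<bar> \<le> \<bar>t ^ 2 * N \<omega> / 2 - t ^ 2 / 2\<bar>"
      using N0 by (intro lip) auto
    also have "\<dots> = \<bar>t ^ 2 / 2 * (N \<omega> - 1)\<bar>"
      by (rule arg_cong[where f=abs]) (simp add: field_simps)
    also have "\<dots> = t ^ 2 / 2 * \<bar>N \<omega> - 1\<bar>"
      by (simp add: abs_mult)
    finally show "cmod (complex_of_real (exp (- (t ^ 2 * N \<omega>) / 2)) - exp (- (t ^ 2) / 2)) \<le> t ^ 2 / 2 * \<bar>N \<omega> - 1\<bar>"
      unfolding of_real_diff[symmetric] norm_of_real by simp
  qed (use gauss in auto)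
  also have "\<dots> = t ^ 2 / 2 * expectation (\<lambda>\<omega>. \<bar>N \<omega> - 1\<bar>)"
    by simp
  also have "\<dots> \<le> t ^ 2 / 2 * sqrt (D - 1)"
  proof (rule mult_left_mono)
    have sq: "(N \<omega> - 1) ^ 2 = N \<omega> ^ 2 - 2 * N \<omega> + 1" for \<omega>
      by (simp add: power2_diff)
    have "expectation (\<lambda>\<omega>. \<bar>N \<omega> - 1\<bar>) \<le> sqrt (expectation (\<lambda>\<omega>. (N \<omega> - 1) ^ 2))"
      by (rule expectation_abs_le_sqrt) (auto simp: sq)
    also have "expectation (\<lambda>\<omega>. (N \<omega> - 1) ^ 2) = expectation (\<lambda>\<omega>. N \<omega> ^ 2) - 1"
      by (simp add: sq EN prob_space)
    finally show "expectation (\<lambda>\<omega>. \<bar>N \<omega> - 1\<bar>) \<le> sqrt (D - 1)"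
      using EN2 by (meson diff_right_mono order_trans real_sqrt_le_mono)
  qed simp
  finally have 2: "cmod (expectation (\<lambda>\<omega>. complex_of_real (exp (- (t ^ 2 * N \<omega>) / 2))) - exp (- (t ^ 2) / 2)) \<le> t ^ 2 / 2 * sqrt (D - 1)" .
  from norm_diff_triangle_le[OF 1 2] show ?thesis
    unfolding G(2) by (simp add: m_def)
qed

end

section \<open>Truncation of the entries and its cost\<close>

text \<open>Truncate at level \<open>L\<close>, recenter and rescale. Since the truncation satisfies
  \<open>g L x ^ 2 = x * g L x\<close> and the identity is centered, the correlation is
  \<open>b L / sqrt (s L)\<close>, which tends to 1 by dominated convergence. Between functions of
  unit variance, correlation near 1 is the same as closeness in \<open>L\<^sup>2\<close>.\<close>

lemma (in real_distribution) bounded_standardized_approx: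
  assumes int1: "integrable M (\<lambda>x. x)" and int2: "integrable M (\<lambda>x. x ^ 2)"
    and mean: "expectation (\<lambda>x. x) = 0" and var: "expectation (\<lambda>x. x ^ 2) = 1" and "\<epsilon> > 0"
  shows "\<exists>f B. centered_L2 M f \<and> expectation (\<lambda>x. f x ^ 2) = 1 \<and> (\<forall>x. \<bar>f x\<bar> \<le> B) \<and>
    expectation (\<lambda>x. x * f x) \<ge> 1 - \<epsilon>"
proof -
  define g where "g = (\<lambda>(L::nat) x. x * indicator {- real L..real L} x :: real)"
  have g_borel [measurable]: "g L \<in> borel_measurable borel" for L
    unfolding g_def by measurable
  have g_meas [measurable]: "g L \<in> borel_measurable M" for L
    unfolding g_def by measurable
  have g_bound: "\<bar>g L x\<bar> \<le> real L" for L x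
    by (auto simp: g_def indicator_def)
  have g_sq: "g L x ^ 2 = x * g L x" for L x
    by (simp add: g_def power2_eq_square indicator_def)
  have g_int [simp]: "integrable M (g L)" "integrable M (\<lambda>x. g L x ^ 2)" for L
  proof -
    have "bounded_rv (g L)"
      using g_bound by (auto simp: bounded_rv_def)
    then show "integrable M (g L)" "integrable M (\<lambda>x. g L x ^ 2)"
      by (auto intro: bounded_rv_integrable)
  qed
  have ev: "\<forall>\<^sub>F L in sequentially. g L x = x" for x
  proof -
    have "\<forall>\<^sub>F L in sequentially. \<bar>x\<bar> \<le> real L"
      using filterlim_real_sequentially by (auto simp: filterlim_at_top)
    then show ?thesis
      by eventually_elim (auto simp: g_def indicator_def)
  qed
  have [simp]: "prob UNIV = 1"
    using prob_space by simp
  define a where "a = (\<lambda>L. expectation (g L))"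
  define b where "b = (\<lambda>L. expectation (\<lambda>x. g L x ^ 2))"
  define s where "s = (\<lambda>L. b L - a L ^ 2)"
  have "a \<longlonglongrightarrow> expectation (\<lambda>x. x)"
    unfolding a_def
  proof (rule integral_dominated_convergence[where w="\<lambda>x. \<bar>x\<bar>"])
    show "AE x in M. (\<lambda>L. g L x) \<longlonglongrightarrow> x"
      by (intro AE_I2 tendsto_eventually ev)
    show "AE x in M. norm (g L x) \<le> \<bar>x\<bar>" for L
      by (intro AE_I2) (simp add: g_def indicator_def)
  qed (rule borel_measurable_integrable[OF int1] g_meas integrable_abs[OF int1])+
  then have a: "a \<longlonglongrightarrow> 0"
    by (simp add: mean)
  have "b \<longlonglongrightarrow> expectation (\<lambda>x. x ^ 2)"
    unfolding b_def
  proof (rule integral_dominated_convergence[where w="\<lambda>x. x ^ 2"])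
    show "AE x in M. (\<lambda>L. g L x ^ 2) \<longlonglongrightarrow> x ^ 2"
      by (intro AE_I2 tendsto_power tendsto_eventually ev)
    show "AE x in M. norm (g L x ^ 2) \<le> x ^ 2" for L
      by (intro AE_I2) (simp add: g_def indicator_def)
  qed (rule borel_measurable_integrable int2 g_int)+
  then have b: "b \<longlonglongrightarrow> 1"
    by (simp add: var)
  have "s \<longlonglongrightarrow> 1 - 0 ^ 2"
    unfolding s_def by (intro tendsto_intros a b)
  then have s: "s \<longlonglongrightarrow> 1"
    by simp
  have "(\<lambda>L. b L / sqrt (s L)) \<longlonglongrightarrow> 1 / sqrt 1"
    by (intro tendsto_intros b s) auto
  then have "(\<lambda>L. b L / sqrt (s L)) \<longlonglongrightarrow> 1"
    by simp
  then have "\<forall>\<^sub>F L in sequentially. b L / sqrt (s L) > 1 - \<epsilon>"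
    using \<open>\<epsilon> > 0\<close> by (intro order_tendstoD(1)) auto
  moreover have "\<forall>\<^sub>F L in sequentially. s L > 0"
    using s by (intro order_tendstoD(1)) auto
  ultimately have "\<forall>\<^sub>F L in sequentially. b L / sqrt (s L) > 1 - \<epsilon> \<and> s L > 0"
    by eventually_elim auto
  then obtain L where L: "b L / sqrt (s L) > 1 - \<epsilon>" "s L > 0"
    using eventually_happens'[OF sequentially_bot] by blast
  define f where "f = (\<lambda>x. (g L x - a L) / sqrt (s L))"
  have [measurable]: "f \<in> borel_measurable borel"
    unfolding f_def by measurable
  have f_sq: "f x ^ 2 = (g L x ^ 2 - 2 * a L * g L x + a L ^ 2) / s L" for x
    using L(2) by (simp add: f_def power_divide power2_diff algebra_simps)
  have xf: "x * f x = (g L x ^ 2 - a L * x) / sqrt (s L)" for x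
    by (simp add: f_def g_sq algebra_simps)
  have "integrable M f" "expectation f = 0"
    by (simp_all add: f_def[abs_def] a_def prob_space)
  moreover have "integrable M (\<lambda>x. f x ^ 2)"
    by (simp add: f_sq)
  moreover have "expectation (\<lambda>x. f x ^ 2) = (b L - 2 * a L * a L + a L ^ 2) / s L"
    by (simp add: f_sq prob_space a_def b_def)
  then have "expectation (\<lambda>x. f x ^ 2) = 1"
    using L(2) by (simp add: s_def power2_eq_square)
  moreover have "\<bar>f x\<bar> \<le> (real L + \<bar>a L\<bar>) / sqrt (s L)" for x
    using g_bound[of L x] L(2) by (auto simp: f_def abs_divide intro!: divide_right_mono)
  moreover have "expectation (\<lambda>x. x * f x) = b L / sqrt (s L)"
    using int1 mean by (simp add: xf b_def)
  then have "expectation (\<lambda>x. x * f x) \<ge> 1 - \<epsilon>"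
    using L(1) by simp
  ultimately show ?thesis
    unfolding centered_L2_def by (auto intro!: exI[of _ f])
qed

text \<open>Factoring out one exponential reduces the integrand to the order-zero Taylor bound for
  \<open>iexp\<close>; the second moment then controls the first absolute moment.\<close>

lemma (in prob_space) char_diff_le:
  fixes S T :: "'a \<Rightarrow> real"
  assumes [measurable]: "S \<in> borel_measurable M" "T \<in> borel_measurable M"
    and int: "integrable M (\<lambda>\<omega>. (S \<omega> - T \<omega>) ^ 2)"
  shows "cmod (expectation (\<lambda>\<omega>. iexp (t * S \<omega>)) - expectation (\<lambda>\<omega>. iexp (t * T \<omega>)))
    \<le> \<bar>t\<bar> * sqrt (expectation (\<lambda>\<omega>. (S \<omega> - T \<omega>) ^ 2))"
proof -
  have 1: "integrable M (\<lambda>\<omega>. iexp (t * S \<omega>))" "integrable M (\<lambda>\<omega>. iexp (t * T \<omega>))"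
    by (intro integrable_const_bound[where B=1]; simp)+
  have "integrable M (\<lambda>\<omega>. S \<omega> - T \<omega>)"
    by (rule square_integrable_imp_integrable[OF _ int]) measurable
  then have 2: "integrable M (\<lambda>\<omega>. \<bar>S \<omega> - T \<omega>\<bar>)"
    by auto
  have "cmod (expectation (\<lambda>\<omega>. iexp (t * S \<omega>)) - expectation (\<lambda>\<omega>. iexp (t * T \<omega>)))
      = cmod (expectation (\<lambda>\<omega>. iexp (t * S \<omega>) - iexp (t * T \<omega>)))"
    using 1 by simp
  also have "\<dots> \<le> expectation (\<lambda>\<omega>. cmod (iexp (t * S \<omega>) - iexp (t * T \<omega>)))"
    by (rule integral_norm_bound)
  also have "\<dots> \<le> expectation (\<lambda>\<omega>. \<bar>t\<bar> * \<bar>S \<omega> - T \<omega>\<bar>)"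
  proof (rule integral_mono)
    fix \<omega>
    have "iexp (t * S \<omega>) - iexp (t * T \<omega>) = iexp (t * T \<omega>) * (iexp (t * (S \<omega> - T \<omega>)) - 1)"
      by (simp add: algebra_simps flip: exp_add)
    also have "cmod \<dots> = cmod (iexp (t * (S \<omega> - T \<omega>)) - 1)"
      by (simp add: norm_mult)
    also have "\<dots> \<le> \<bar>t * (S \<omega> - T \<omega>)\<bar>"
      using iexp_approx1[of "t * (S \<omega> - T \<omega>)" 0] by simp
    finally show "cmod (iexp (t * S \<omega>) - iexp (t * T \<omega>)) \<le> \<bar>t\<bar> * \<bar>S \<omega> - T \<omega>\<bar>"
      by (simp add: abs_mult)
  qed (use 1 2 in auto)
  also have "\<dots> = \<bar>t\<bar> * expectation (\<lambda>\<omega>. \<bar>S \<omega> - T \<omega>\<bar>)"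
    by simp
  also have "\<dots> \<le> \<bar>t\<bar> * sqrt (expectation (\<lambda>\<omega>. (S \<omega> - T \<omega>) ^ 2))"
    using int by (intro mult_left_mono expectation_abs_le_sqrt) auto
  finally show ?thesis .
qed

text \<open>Expand the squared distance of the two sums: both norms and the inner product come from
  \<open>chain_sum_correlation\<close>, so the dimensions do not appear.\<close>

lemma (in entry_array) chain_sum_char_diff:
  assumes f: "\<And>r. r \<in> {1..p} \<Longrightarrow> centered_L2 (\<mu> r) (f r)"
    and g: "\<And>r. r \<in> {1..p} \<Longrightarrow> centered_L2 (\<mu> r) (g r)" and "p \<ge> 1"
    and f1: "\<And>r. r \<in> {1..p} \<Longrightarrow> (\<integral>x. f r x ^ 2 \<partial>\<mu> r) = 1"
    and g1: "\<And>r. r \<in> {1..p} \<Longrightarrow> (\<integral>x. g r x ^ 2 \<partial>\<mu> r) = 1"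
  shows "cmod (expectation (\<lambda>\<omega>. iexp (t * (\<Sum>j<n p. rvec f p j \<omega>))) - expectation (\<lambda>\<omega>. iexp (t * (\<Sum>j<n p. rvec g p j \<omega>))))
    \<le> \<bar>t\<bar> * sqrt (2 - 2 * (\<Prod>r=1..p. \<integral>x. f r x * g r x \<partial>\<mu> r))"
proof -
  define S where "S = (\<lambda>\<omega>. \<Sum>j<n p. rvec f p j \<omega>)"
  define T where "T = (\<lambda>\<omega>. \<Sum>j<n p. rvec g p j \<omega>)"
  have [measurable]: "S \<in> borel_measurable M" "T \<in> borel_measurable M"
    unfolding S_def T_def using f g
    by (auto intro!: borel_measurable_sum rvec_rv simp: centered_L2_def)
  have int: "integrable M (\<lambda>\<omega>. S \<omega> ^ 2)" "integrable M (\<lambda>\<omega>. T \<omega> ^ 2)" "integrable M (\<lambda>\<omega>. S \<omega> * T \<omega>)"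
    and ES: "expectation (\<lambda>\<omega>. S \<omega> ^ 2) = 1" and ET: "expectation (\<lambda>\<omega>. T \<omega> ^ 2) = 1"
    and EST: "expectation (\<lambda>\<omega>. S \<omega> * T \<omega>) = (\<Prod>r=1..p. \<integral>x. f r x * g r x \<partial>\<mu> r)"
    using chain_sum_correlation[OF f f \<open>p \<ge> 1\<close>] chain_sum_correlation[OF g g \<open>p \<ge> 1\<close>]
      chain_sum_correlation[OF f g \<open>p \<ge> 1\<close>] f1 g1
    by (simp_all add: S_def T_def power2_eq_square)
  have eq: "(S \<omega> - T \<omega>) ^ 2 = S \<omega> ^ 2 + T \<omega> ^ 2 - 2 * (S \<omega> * T \<omega>)" for \<omega>
    by (simp add: power2_diff)
  have "expectation (\<lambda>\<omega>. (S \<omega> - T \<omega>) ^ 2) = 2 - 2 * (\<Prod>r=1..p. \<integral>x. f r x * g r x \<partial>\<mu> r)"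
    unfolding eq using int ES ET EST by simp
  moreover have "integrable M (\<lambda>\<omega>. (S \<omega> - T \<omega>) ^ 2)"
    unfolding eq using int by simp
  ultimately have "cmod (expectation (\<lambda>\<omega>. iexp (t * S \<omega>)) - expectation (\<lambda>\<omega>. iexp (t * T \<omega>)))
      \<le> \<bar>t\<bar> * sqrt (2 - 2 * (\<Prod>r=1..p. \<integral>x. f r x * g r x \<partial>\<mu> r))"
    using char_diff_le[of S T t] by simp
  then show ?thesis
    by (simp only: S_def T_def)
qed

section \<open>From random matrices to one array of entries\<close>

text \<open>Independence at two levels is merged by factoring probabilities twice: first over the
  matrices, each seen as a block, then over the entries of each block. Positive dimensions make the
  blocks nonempty, as the finite product formulas require.\<close>

lemma (in prob_space) joint_entries_indep:
  assumes mats: "indep_matrices M (\<lambda>q. n (q - 1)) n A {1..p}"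
    and iid: "\<And>q. q \<in> {1..p} \<Longrightarrow> iid_entries M (n (q - 1)) (n q) (A q) (\<mu> q)"
    and pos: "\<And>q. q \<le> p \<Longrightarrow> n q \<ge> 1" and "p \<ge> 1"
  shows "indep_vars (\<lambda>_. borel) (\<lambda>(q, ij) \<omega>. A q \<omega> $$ ij) (entries n p)"
proof -
  define R where "R = (\<lambda>q. {..<n (q - 1)} \<times> {..<n q})"
  define X where "X = (\<lambda>(q, ij) \<omega>. A q \<omega> $$ ij)"
  have T: "entries n p = Sigma {1..p} R"
    by (auto simp: entries_def layer_def R_def)
  have fin: "finite (R q)" for q
    by (simp add: R_def)
  have ne: "R q \<noteq> {}" if "q \<in> {1..p}" for q
  proof -
    have "q \<le> p" "q - 1 \<le> p"
      using that by auto
    then show ?thesis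
      using pos[of q] pos[of "q - 1"] by (auto simp: R_def lessThan_empty_iff)
  qed
  have ind: "indep_vars (\<lambda>_. borel) (\<lambda>ij \<omega>. A q \<omega> $$ ij) (R q)" if "q \<in> {1..p}" for q
    using iid[OF that] by (simp add: iid_entries_def R_def)
  have indm: "indep_vars (\<lambda>q. PiM (R q) (\<lambda>_. borel)) (\<lambda>q \<omega>. restrict (($$) (A q \<omega>)) (R q)) {1..p}"
    using mats by (simp add: indep_matrices_def R_def)
  have Xeq: "X (q, ij) = (\<lambda>\<omega>. A q \<omega> $$ ij)" for q ij
    by (simp add: X_def)
  have "indep_vars (\<lambda>_. borel) X (entries n p)"
  \<comment> \<open>With all Borel sets as the intersection-stable generator, independence becomes a
    product formula over the whole finite index set.\<close>
  proof (subst indep_vars_finite[where E="\<lambda>_. sets borel"])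
    show "entries n p \<noteq> {}"
      unfolding T Sigma_empty_iff using ne[of 1] \<open>p \<ge> 1\<close> by (metis atLeastAtMost_iff order_refl)
    show "finite (entries n p)"
      unfolding T using fin by auto
    show "random_variable borel (X t)" if "t \<in> entries n p" for t
      using that ind unfolding T by (auto simp: Xeq indep_vars_def)
    show "\<forall>A\<in>entries n p \<rightarrow> sets borel.
      prob (\<Inter>t\<in>entries n p. X t -` A t \<inter> space M) = (\<Prod>t\<in>entries n p. prob (X t -` A t \<inter> space M))"
    proof
      fix E :: "nat \<times> nat \<times> nat \<Rightarrow> real set" assume E: "E \<in> entries n p \<rightarrow> sets borel"
      \<comment> \<open>The constraints on the entries of matrix \<open>q\<close> form one
        measurable rectangle for the block, an event to which \<open>indep_matrices\<close>
        applies.\<close>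
      define G where "G = (\<lambda>q. (\<lambda>\<omega>. restrict (($$) (A q \<omega>)) (R q)) -` (PiE (R q) (\<lambda>ij. E (q, ij))) \<inter> space M)"
      have G: "G q = (\<Inter>ij\<in>R q. X (q, ij) -` E (q, ij) \<inter> space M)" if "q \<in> {1..p}" for q
        using ne[OF that] by (auto simp: G_def Xeq PiE_iff)
      have "(\<Inter>t\<in>entries n p. X t -` E t \<inter> space M) = (\<Inter>q\<in>{1..p}. G q)"
      proof -
        define H where "H = (\<lambda>t. X t -` E t \<inter> space M)"
        have "(\<Inter>t\<in>Sigma {1..p} R. H t) = (\<Inter>q\<in>{1..p}. \<Inter>ij\<in>R q. H (q, ij))"
          by auto
        also have "\<dots> = (\<Inter>q\<in>{1..p}. G q)"
          by (rule INF_cong[OF refl]) (simp only: G H_def)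
        finally show ?thesis
          by (simp only: T H_def)
      qed
      then have "prob (\<Inter>t\<in>entries n p. X t -` E t \<inter> space M) = prob (\<Inter>q\<in>{1..p}. G q)"
        by simp
      also have "\<dots> = (\<Prod>q\<in>{1..p}. prob (G q))"
        unfolding G_def
        by (rule indep_varsD_finite[OF indm]) (use \<open>p \<ge> 1\<close> fin E in \<open>auto simp: T intro!: sets_PiM_I_finite\<close>)
      also have "\<dots> = (\<Prod>q\<in>{1..p}. \<Prod>ij\<in>R q. prob (X (q, ij) -` E (q, ij) \<inter> space M))"
      proof (rule prod.cong[OF refl])
        fix q assume q: "q \<in> {1..p}"
        show "prob (G q) = (\<Prod>ij\<in>R q. prob (X (q, ij) -` E (q, ij) \<inter> space M))"
          unfolding G[OF q] Xeq
          by (rule indep_varsD_finite[OF ind[OF q] ne[OF q] fin]) (use E q in \<open>auto simp: T\<close>)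
      qed
      also have "\<dots> = (\<Prod>t\<in>entries n p. prob (X t -` E t \<inter> space M))"
        unfolding T using fin by (subst prod.Sigma) (auto intro!: prod.cong)
      finally show "prob (\<Inter>t\<in>entries n p. X t -` E t \<inter> space M) = (\<Prod>t\<in>entries n p. prob (X t -` E t \<inter> space M))" .
    qed
  qed (auto simp: Int_stable_def sets.sigma_sets_eq[of borel, simplified])
  then show ?thesis
    by (simp add: X_def)
qed

lemma mat_chain_carrier:
  assumes "\<And>q. q \<in> {1..p} \<Longrightarrow> B q \<in> carrier_mat (n (q - 1)) (n q)" "q \<le> p"
  shows "mat_chain (n 0) B q \<in> carrier_mat (n 0) (n q)"
  using assms(2)
proof (induction q)
  case (Suc q)
  then show ?case
    using assms(1)[of "Suc q"] by (auto intro: mult_carrier_mat)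
qed simp

text \<open>Column sums are the product of the all-ones row vector with the chain, so they obey the
  recursion of \<open>chain_vec\<close>; the square root collects the factors
  \<open>1 / sqrt (n r)\<close> built into that recursion, including \<open>r = 0\<close>.\<close>

lemma mat_chain_column_sum:
  assumes B: "\<And>q. q \<in> {1..p} \<Longrightarrow> B q \<in> carrier_mat (n (q - 1)) (n q)"
    and pos: "\<And>q. q \<le> p \<Longrightarrow> n q \<ge> 1" and "q \<le> p" "j < n q"
  shows "(\<Sum>i<n 0. mat_chain (n 0) B q $$ (i, j)) =
    sqrt (\<Prod>r\<le>q. real (n r)) * chain_vec n (\<lambda>_ x. x) q j (\<lambda>(r, ij). B r $$ ij)"
  using assms(3,4)
proof (induction q arbitrary: j)
  case 0
  then have "(\<Sum>i<n 0. mat_chain (n 0) B 0 $$ (i, j)) = (\<Sum>i<n 0. if i = j then 1 else 0)"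
    by (intro sum.cong) auto
  then show ?case
    using 0 pos[of 0] by simp
next
  case (Suc q)
  define C where "C = mat_chain (n 0) B q"
  have C: "C \<in> carrier_mat (n 0) (n q)"
    unfolding C_def using B Suc.prems by (intro mat_chain_carrier[where p=p]) auto
  have BS: "B (Suc q) \<in> carrier_mat (n q) (n (Suc q))"
    using B[of "Suc q"] Suc.prems by auto
  have "(\<Sum>i<n 0. mat_chain (n 0) B (Suc q) $$ (i, j)) = (\<Sum>i<n 0. \<Sum>k<n q. C $$ (i, k) * B (Suc q) $$ (k, j))"
    using C BS Suc.prems by (simp add: C_def[symmetric] scalar_prod_def lessThan_atLeast0)
  also have "\<dots> = (\<Sum>k<n q. (\<Sum>i<n 0. C $$ (i, k)) * B (Suc q) $$ (k, j))"
    by (subst sum.swap) (simp add: sum_distrib_right)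
  also have "\<dots> = (\<Sum>k<n q. sqrt (\<Prod>r\<le>q. real (n r)) * chain_vec n (\<lambda>_ x. x) q k (\<lambda>(r, ij). B r $$ ij) * B (Suc q) $$ (k, j))"
    using Suc by (intro sum.cong refl) (simp add: C_def)
  also have "\<dots> = sqrt (\<Prod>r\<le>Suc q. real (n r)) * chain_vec n (\<lambda>_ x. x) (Suc q) j (\<lambda>(r, ij). B r $$ ij)"
    using pos[of "Suc q"] Suc.prems by (simp add: real_sqrt_mult sum_distrib_left sum_divide_distrib mult_ac)
  finally show ?case .
qed

section \<open>Convergence of characteristic functions along a sequence of dimensions\<close>

theorem theorem1p8:
  fixes \<alpha> :: real and p :: nat
    and \<mu> :: "nat \<Rightarrow> real measure"
    and M :: "(nat \<Rightarrow> nat) \<Rightarrow> 'a measure"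
    and A :: "(nat \<Rightarrow> nat) \<Rightarrow> nat \<Rightarrow> 'a \<Rightarrow> real mat"
  assumes "\<alpha> > 1" and "p \<ge> 1"
    and "\<And>q. q \<in> {1..p} \<Longrightarrow> real_distribution (\<mu> q)"
    and "\<And>q. q \<in> {1..p} \<Longrightarrow> prob_space.expectation (\<mu> q) (\<lambda>x. x) = 0"
    and "\<And>q. q \<in> {1..p} \<Longrightarrow> prob_space.variance (\<mu> q) (\<lambda>x. x) = 1"
    and "\<And>q. q \<in> {1..p} \<Longrightarrow> integrable (\<mu> q) (\<lambda>x. \<bar>x\<bar> powr (2 * \<alpha>))"
    and "\<And>n. (\<forall>q\<le>p. n q \<ge> 1) \<Longrightarrow> prob_space (M n)"
    and "\<And>n. (\<forall>q\<le>p. n q \<ge> 1) \<Longrightarrow> indep_matrices (M n) (\<lambda>q. n (q - 1)) n (A n) {1..p}"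
    and "\<And>n q. (\<forall>q\<le>p. n q \<ge> 1) \<Longrightarrow> q \<in> {1..p} \<Longrightarrow>
           iid_entries (M n) (n (q - 1)) (n q) (A n q) (\<mu> q)"
  shows "conv_law_comparable p
           (\<lambda>n. distr (M n) borel (\<lambda>\<omega>.
              (\<Prod>q\<le>p. real (n q)) powr (- 1 / 2) *
              (\<Sum>i<n 0. \<Sum>j<n p. mat_chain (n 0) (\<lambda>q. A n q \<omega>) p $$ (i, j))))
           std_normal_distribution"
  unfolding conv_law_comparable_def
proof (intro allI impI)
  fix C :: real and n :: "nat \<Rightarrow> nat \<Rightarrow> nat"
  assume pos: "\<forall>k. \<forall>q\<le>p. n k q \<ge> 1"
    and lim: "filterlim (\<lambda>k. Min (n k ` {..p})) at_top sequentially"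
  note real = assms(3) and mean = assms(4)
  define X where "X = (\<lambda>k (q, ij) \<omega>. A (n k) q \<omega> $$ ij)"
  define S where "S = (\<lambda>k \<omega>. \<Sum>j<n k p. chain_vec (n k) (\<lambda>_ x. x) p j (\<lambda>t. X k t \<omega>))"
  interpret prob_space "M (n k)" for k
    using assms(7) pos by blast
  have arr: "entry_array (M (n k)) (n k) p (X k) \<mu>" for k
  proof
    show "indep_vars k (\<lambda>_. borel) (X k) (entries (n k) p)"
      unfolding X_def using assms(2,8,9) pos by (intro joint_entries_indep[where \<mu>=\<mu>]) auto
    show "distr (M (n k)) borel (X k t) = \<mu> (fst t)" if "t \<in> entries (n k) p" for t
    proof (cases t)
      case (fields q i j)
      with that have "q \<in> {1..p}" "(i, j) \<in> {..<n k (q - 1)} \<times> {..<n k q}"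
        by auto
      then show ?thesis
        using assms(9)[of "n k" q] pos fields by (simp add: iid_entries_def X_def)
    qed
  qed (use pos in auto)
  \<comment> \<open>Restricted to \<open>space (M (n k))\<close>, since only there does
    \<open>iid_entries\<close> fix the sizes of the matrices.\<close>
  have sum_eq: "(\<Prod>q\<le>p. real (n k q)) powr (- 1 / 2) *
      (\<Sum>i<n k 0. \<Sum>j<n k p. mat_chain (n k 0) (\<lambda>q. A (n k) q \<omega>) p $$ (i, j)) = S k \<omega>"
    if "\<omega> \<in> space (M (n k))" for k \<omega>
  proof -
    define P where "P = (\<Prod>q\<le>p. real (n k q))"
    have "P > 0"
      unfolding P_def using pos by (intro prod_pos) (auto simp: Suc_le_eq)
    have "(\<Sum>i<n k 0. \<Sum>j<n k p. mat_chain (n k 0) (\<lambda>q. A (n k) q \<omega>) p $$ (i, j))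
      = (\<Sum>j<n k p. \<Sum>i<n k 0. mat_chain (n k 0) (\<lambda>q. A (n k) q \<omega>) p $$ (i, j))"
      by (rule sum.swap)
    also have "\<dots> = (\<Sum>j<n k p. sqrt P * chain_vec (n k) (\<lambda>_ x. x) p j (\<lambda>(r, ij). A (n k) r \<omega> $$ ij))"
      unfolding P_def
      using assms(9)[of "n k"] pos that
      by (intro sum.cong refl mat_chain_column_sum[where p=p]) (auto simp: iid_entries_def)
    also have "\<dots> = sqrt P * S k \<omega>"
      by (simp add: S_def X_def sum_distrib_left case_prod_beta')
    finally show ?thesis
      using \<open>P > 0\<close> by (simp add: powr_minus powr_half_sqrt flip: P_def)
  qed
  have mu: "centered_L2 (\<mu> r) (\<lambda>x. x)" "(\<integral>x. x ^ 2 \<partial>\<mu> r) = 1" if r: "r \<in> {1..p}" for r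
  proof -
    interpret R: real_distribution "\<mu> r"
      by (rule real[OF r])
    have var: "(\<integral>x. x ^ 2 \<partial>\<mu> r) = 1"
      using assms(5)[OF r] by (simp add: mean[OF r])
    \<comment> \<open>The integral of a non-integrable function is 0 by convention, so the value 1
      forces integrability.\<close>
    have "integrable (\<mu> r) (\<lambda>x. x ^ 2)"
      using var not_integrable_integral_eq by fastforce
    then show "centered_L2 (\<mu> r) (\<lambda>x. x)"
      using mean[OF r] by (auto simp: centered_L2_def intro!: R.square_integrable_imp_integrable[of "\<lambda>x. x"])
    show "(\<integral>x. x ^ 2 \<partial>\<mu> r) = 1"
      by (rule var)
  qed
  have S_rv: "S k \<in> borel_measurable (M (n k))" for k
  proof -
    interpret E: entry_array "M (n k)" "n k" p "X k" \<mu>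
      by (rule arr)
    show ?thesis
      unfolding S_def using mu by (intro borel_measurable_sum E.rvec_rv) auto
  qed
  have "weak_conv_m (\<lambda>k. distr (M (n k)) borel (S k)) std_normal_distribution"
  proof (rule levy_continuity)
    show "real_distribution (distr (M (n k)) borel (S k))" for k
      using S_rv by (rule real_distribution_distr)
    show "real_distribution std_normal_distribution"
      by (rule real_dist_normal_dist)
    fix t :: real
    have char_S: "char (distr (M (n k)) borel (S k)) t = expectation k (\<lambda>\<omega>. iexp (t * S k \<omega>))" for k
      unfolding char_def using S_rv by (intro integral_distr) auto
    have "(\<lambda>k. expectation k (\<lambda>\<omega>. iexp (t * S k \<omega>))) \<longlonglongrightarrow> complex_of_real (exp (- (t ^ 2) / 2))"
    proof (rule tendstoI)
      fix e :: real assume "e > 0"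
      \<comment> \<open>This is the truncation cost when each one-entry correlation is at least
        \<open>1 - \<delta>\<close>. It does not involve \<open>k\<close>, so
        \<open>\<delta>\<close> can be fixed first; \<open>\<delta> < 1\<close> keeps the factors
        nonnegative when the products are compared.\<close>
      have "((\<lambda>\<delta>. \<bar>t\<bar> * sqrt (2 - 2 * (1 - \<delta>) ^ p)) \<longlongrightarrow> 0) (at_right 0)"
        by (rule tendsto_eq_intros refl | simp)+
      then have "\<forall>\<^sub>F \<delta> in at_right 0. \<bar>t\<bar> * sqrt (2 - 2 * (1 - \<delta>) ^ p) < e / 2"
        using \<open>e > 0\<close> by (intro order_tendstoD(2)) auto
      moreover have "\<forall>\<^sub>F \<delta>::real in at_right 0. \<delta> \<in> {0<..<1}"
        by (rule eventually_at_right_real) simp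
      ultimately have "\<forall>\<^sub>F \<delta> in at_right 0. \<bar>t\<bar> * sqrt (2 - 2 * (1 - \<delta>) ^ p) < e / 2 \<and> \<delta> \<in> {0<..<1}"
        by eventually_elim auto
      then obtain \<delta> where \<delta>: "\<bar>t\<bar> * sqrt (2 - 2 * (1 - \<delta>) ^ p) < e / 2" "0 < \<delta>" "\<delta> < 1"
        using eventually_happens'[OF trivial_limit_at_right_real] by fastforce
      have "\<forall>r\<in>{1..p}. \<exists>f. \<exists>B. centered_L2 (\<mu> r) f \<and> (\<integral>x. f x ^ 2 \<partial>\<mu> r) = 1 \<and>
        (\<forall>x. \<bar>f x\<bar> \<le> B) \<and> (\<integral>x. x * f x \<partial>\<mu> r) \<ge> 1 - \<delta>"
      proof
        fix r assume r: "r \<in> {1..p}"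
        have "integrable (\<mu> r) (\<lambda>x. x)" "integrable (\<mu> r) (\<lambda>x. x ^ 2)"
          using mu(1)[OF r] by (simp_all only: centered_L2_def)
        then show "\<exists>f. \<exists>B. centered_L2 (\<mu> r) f \<and> (\<integral>x. f x ^ 2 \<partial>\<mu> r) = 1 \<and>
          (\<forall>x. \<bar>f x\<bar> \<le> B) \<and> (\<integral>x. x * f x \<partial>\<mu> r) \<ge> 1 - \<delta>"
          by (rule real_distribution.bounded_standardized_approx[OF real[OF r] _ _ mean[OF r] mu(2)[OF r] \<delta>(2)])
      qed
      from bchoice[OF this] obtain f where "\<forall>r\<in>{1..p}. \<exists>B. centered_L2 (\<mu> r) (f r) \<and>
        (\<integral>x. f r x ^ 2 \<partial>\<mu> r) = 1 \<and> (\<forall>x. \<bar>f r x\<bar> \<le> B) \<and> (\<integral>x. x * f r x \<partial>\<mu> r) \<ge> 1 - \<delta>" ..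
      from bchoice[OF this] obtain B' where B': "\<forall>r\<in>{1..p}. centered_L2 (\<mu> r) (f r) \<and>
        (\<integral>x. f r x ^ 2 \<partial>\<mu> r) = 1 \<and> (\<forall>x. \<bar>f r x\<bar> \<le> B' r) \<and> (\<integral>x. x * f r x \<partial>\<mu> r) \<ge> 1 - \<delta>" ..
      then have f: "centered_L2 (\<mu> r) (f r)" "(\<integral>x. f r x ^ 2 \<partial>\<mu> r) = 1" "(\<integral>x. x * f r x \<partial>\<mu> r) \<ge> 1 - \<delta>"
        if "r \<in> {1..p}" for r
        using that by simp_all
      \<comment> \<open>A common bound for the finitely many replacements.\<close>
      define B where "B = (\<Sum>r\<in>{1..p}. \<bar>B' r\<bar>)"
      have B: "\<bar>f r x\<bar> \<le> B" if r: "r \<in> {1..p}" for r x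
      proof -
        have "\<bar>f r x\<bar> \<le> \<bar>B' r\<bar>"
          using B' r abs_ge_self order_trans by blast
        also have "\<dots> \<le> B"
          unfolding B_def using r by (intro member_le_sum) auto
        finally show ?thesis .
      qed
      define T where "T = (\<lambda>k \<omega>. \<Sum>j<n k p. chain_vec (n k) f p j (\<lambda>t. X k t \<omega>))"
      obtain q where q: "p = Suc q"
        using \<open>p \<ge> 1\<close> by (cases p) auto
      define D where "D = (\<lambda>k. \<Prod>r=1..q. 1 + (3 + B ^ 2) / real (n k r))"
      define b where "b = (\<lambda>k. B * \<bar>t\<bar> ^ 3 * (1 + D k) / (6 * sqrt (real (n k p))) + t ^ 4 * D k / (8 * real (n k p))
        + t ^ 2 / 2 * sqrt (D k - 1))"
      have le: "cmod (expectation k (\<lambda>\<omega>. iexp (t * S k \<omega>)) - complex_of_real (exp (- (t ^ 2) / 2)))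
        \<le> \<bar>t\<bar> * sqrt (2 - 2 * (1 - \<delta>) ^ p) + b k" for k
      proof -
        interpret E: entry_array "M (n k)" "n k" p "X k" \<mu>
          by (rule arr)
        have "cmod (expectation k (\<lambda>\<omega>. iexp (t * S k \<omega>)) - expectation k (\<lambda>\<omega>. iexp (t * T k \<omega>)))
          \<le> \<bar>t\<bar> * sqrt (2 - 2 * (\<Prod>r=1..p. \<integral>x. x * f r x \<partial>\<mu> r))"
          unfolding S_def T_def using mu f \<open>p \<ge> 1\<close> by (intro E.chain_sum_char_diff) auto
        also have "\<dots> \<le> \<bar>t\<bar> * sqrt (2 - 2 * (1 - \<delta>) ^ p)"
        proof -
          have "(\<Prod>r=1..p. 1 - \<delta>) \<le> (\<Prod>r=1..p. \<integral>x. x * f r x \<partial>\<mu> r)"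
            using f(3) \<delta> by (intro prod_mono) auto
          then show ?thesis
            by (intro mult_left_mono real_sqrt_le_mono) auto
        qed
        finally have 1: "cmod (expectation k (\<lambda>\<omega>. iexp (t * S k \<omega>)) - expectation k (\<lambda>\<omega>. iexp (t * T k \<omega>)))
          \<le> \<bar>t\<bar> * sqrt (2 - 2 * (1 - \<delta>) ^ p)" .
        have 2: "cmod (expectation k (\<lambda>\<omega>. iexp (t * T k \<omega>)) - complex_of_real (exp (- (t ^ 2) / 2))) \<le> b k"
          unfolding T_def b_def D_def using f B q by (intro E.chain_sum_char_bound) auto
        show ?thesis
          by (rule norm_diff_triangle_le[OF 1 2])
      qed
      have n_lim: "filterlim (\<lambda>k. real (n k r)) at_top sequentially" if "r \<le> p" for r
        by (rule filterlim_compose[OF filterlim_real_sequentially filterlim_at_top_mono[OF lim]])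
          (use that in auto)
      \<comment> \<open>\<open>B\<close> depends on \<open>\<delta>\<close> but not on
        \<open>k\<close>, so each of the finitely many factors tends to 1.\<close>
      have "D \<longlonglongrightarrow> (\<Prod>r=1..q. 1 + 0)"
        unfolding D_def
        by (intro tendsto_prod tendsto_add tendsto_const tendsto_divide_0[OF tendsto_const]
            filterlim_at_top_imp_at_infinity n_lim) (use q in auto)
      then have D: "D \<longlonglongrightarrow> 1"
        by simp
      have sqrt_lim: "filterlim (\<lambda>k. 6 * sqrt (real (n k p))) at_infinity sequentially"
        by (intro filterlim_at_top_imp_at_infinity filterlim_tendsto_pos_mult_at_top[OF tendsto_const]
            filterlim_compose[OF sqrt_at_top] n_lim) auto
      have lin_lim: "filterlim (\<lambda>k. 8 * real (n k p)) at_infinity sequentially"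
        by (intro filterlim_at_top_imp_at_infinity filterlim_tendsto_pos_mult_at_top[OF tendsto_const] n_lim) auto
      have num1: "(\<lambda>k. B * \<bar>t\<bar> ^ 3 * (1 + D k)) \<longlonglongrightarrow> B * \<bar>t\<bar> ^ 3 * (1 + 1)"
        and num2: "(\<lambda>k. t ^ 4 * D k) \<longlonglongrightarrow> t ^ 4 * 1"
        by (intro tendsto_intros D)+
      \<comment> \<open>The first two terms vanish because \<open>n k p\<close> tends to infinity,
        the third because the variance bound \<open>D k - 1\<close> tends to 0.\<close>
      have "b \<longlonglongrightarrow> 0 + 0 + t ^ 2 / 2 * sqrt (1 - 1)"
        unfolding b_def
        by (intro tendsto_add tendsto_divide_0[OF num1 sqrt_lim] tendsto_divide_0[OF num2 lin_lim]
            tendsto_mult tendsto_const tendsto_real_sqrt tendsto_diff D)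
      then have "b \<longlonglongrightarrow> 0"
        by simp
      then have "\<forall>\<^sub>F k in sequentially. b k < e / 2"
        using \<open>e > 0\<close> by (intro order_tendstoD(2)) auto
      then show "\<forall>\<^sub>F k in sequentially. dist (expectation k (\<lambda>\<omega>. iexp (t * S k \<omega>))) (complex_of_real (exp (- (t ^ 2) / 2))) < e"
      proof eventually_elim
        case (elim k)
        then show ?case
          unfolding dist_norm using le[of k] \<delta>(1) by linarith
      qed
    qed
    then show "(\<lambda>k. char (distr (M (n k)) borel (S k)) t) \<longlonglongrightarrow> char std_normal_distribution t"
      by (simp add: char_S char_std_normal_distribution)
  qed
  moreover have "distr (M (n k)) borel (S k) = distr (M (n k)) borel (\<lambda>\<omega>. (\<Prod>q\<le>p. real (n k q)) powr (- 1 / 2) *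
      (\<Sum>i<n k 0. \<Sum>j<n k p. mat_chain (n k 0) (\<lambda>q. A (n k) q \<omega>) p $$ (i, j)))" for k
    by (intro distr_cong refl sum_eq[symmetric])
  ultimately show "weak_conv_m (\<lambda>k. distr (M (n k)) borel (\<lambda>\<omega>. (\<Prod>q\<le>p. real (n k q)) powr (- 1 / 2) *
      (\<Sum>i<n k 0. \<Sum>j<n k p. mat_chain (n k 0) (\<lambda>q. A (n k) q \<omega>) p $$ (i, j)))) std_normal_distribution"
    by simp
qed

end
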